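(* Let $G=N(m)$ with positive conductances satisfying $R_1\ge R_2\ge\cdots\ge R_m$, and fix one of the edges of $G(\infty)$ incident to one of the left boundary vertices $\dots,-2,-1,0,1,2,\dots$; let $a$ be its conductance. Then there are sequences of polynomials $P_1,P_2,\dots$ and $Q_1,Q_2,\dots$ (each in finitely many of the variables $x_{uv}$, $u,v\in\mathbb{Z}\cup\mathbb{Z}'$, and possibly depending on the universal response matrix $\mathcal{L}$ of $G$) such that $$\lim_{K\to\infty}\frac{P_K(\mathcal{L})}{Q_K(\mathcal{L})}=a,$$ where $P_K(\mathcal{L})$, $Q_K(\mathcal{L})$ denote evaluation at $x_{uv}=\mathcal{L}_{uv}$.
   Context: Fix $n,m\ge1$. $N(m)$ is the cylindrical network with vertices $M^{(k)}_i$ ($0\le k\le m$, $i\in\mathbb{Z}/n$), boundary vertices $i=M^{(0)}_i$ (left) and $i'=M^{(m)}_i$ (right), and edges $M^{(k)}_i$–$M^{(k+1)}_i$ and $M^{(k)}_i$–$M^{(k+1)}_{i-1}$, $0\le k\le m-1$, with positive conductances $w$. Radii: $R_k=\prod_{i=1}^n w(M^{(k-1)}_iM^{(k)}_{i-1})\big/\prod_{i=1}^n w(M^{(k-1)}_iM^{(k)}_i)$. The universal cover $G(\infty)$ has the same description with $i\in\mathbb{Z}$ and $n$-periodic conductances; boundary vertices $i\in\mathbb{Z}$, $i'\in\mathbb{Z}'$. For finite vertex sets $V_1\subseteq V_2\subseteq\cdots$ exhausting $G(\infty)$, the truncation $G(N)$ consists of all edges incident to $V_N$, a vertex being interior iff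 in $V_N$ and interior in $G(\infty)$. The response matrix of a finite network is the Schur complement of its Kirchhoff matrix ($K_{uv}=\sum_{e\text{ joins }u,v}w(e)$, $u\ne v$; $K_{uu}=-\sum_{e\ni u}w(e)$) with respect to interior vertices; the universal response matrix is $\mathcal{L}_{uv}=\lim_N L_{uv}(G(N))$, $u,v\in\mathbb{Z}\cup\mathbb{Z}'$. *)

theory Defs
  imports Complex_Main "HOL-Library.Poly_Mapping"
begin

section \<open>Response matrices of finite networks\<close>

text \<open>
  A network is given by its set of edges, a map sending each edge to its set of endpoints,
  the conductances, and the set of interior vertices.  Its vertices are the endpoints of its edges;
  matrix entries at other indices are irrelevant.
\<close>

definition kirchhoff :: "'e set \<Rightarrow> ('e \<Rightarrow> 'v set) \<Rightarrow> ('e \<Rightarrow> real) \<Rightarrow> 'v \<Rightarrow> 'v \<Rightarrow> real" where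
  "kirchhoff E ends w u v =
     (if u = v then - (\<Sum>e | e \<in> E \<and> u \<in> ends e. w e)
      else (\<Sum>e | e \<in> E \<and> ends e = {u, v}. w e))"

text \<open>
  The inverse of the submatrix of \<open>A\<close> with rows and columns in the finite set \<open>I\<close>,
  extended by zero.
\<close>

definition inverse_on :: "'v set \<Rightarrow> ('v \<Rightarrow> 'v \<Rightarrow> real) \<Rightarrow> 'v \<Rightarrow> 'v \<Rightarrow> real" where
  "inverse_on I A = (THE B.
     (\<forall>u v. u \<notin> I \<or> v \<notin> I \<longrightarrow> B u v = 0) \<and>
     (\<forall>u\<in>I. \<forall>v\<in>I. (\<Sum>x\<in>I. A u x * B x v) = (if u = v then 1 else 0)) \<and>
     (\<forall>u\<in>I. \<forall>v\<in>I. (\<Sum>x\<in>I. B u x * A x v) = (if u = v then 1 else 0)))"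

definition schur_complement :: "'v set \<Rightarrow> ('v \<Rightarrow> 'v \<Rightarrow> real) \<Rightarrow> 'v \<Rightarrow> 'v \<Rightarrow> real" where
  "schur_complement I A u v = A u v - (\<Sum>x\<in>I. \<Sum>y\<in>I. A u x * inverse_on I A x y * A y v)"

definition response ::
  "'e set \<Rightarrow> ('e \<Rightarrow> 'v set) \<Rightarrow> ('e \<Rightarrow> real) \<Rightarrow> 'v set \<Rightarrow> 'v \<Rightarrow> 'v \<Rightarrow> real" where
  "response E ends w I = schur_complement I (kirchhoff E ends w)"

section \<open>The cylindrical network and its universal cover\<close>

text \<open>
  \<open>M k i\<close> is the vertex $M^{(k)}_i$; \<open>Straight k i\<close> is the edge joining \<open>M k i\<close> and \<open>M (k + 1) i\<close>,
  and \<open>Slanted k i\<close> is the edge joining \<open>M k i\<close> and \<open>M (k + 1) (i - 1)\<close>.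
\<close>

datatype vertex = M nat int

datatype edge = Straight nat int | Slanted nat int

fun ends :: "edge \<Rightarrow> vertex set" where
  "ends (Straight k i) = {M k i, M (Suc k) i}"
| "ends (Slanted k i) = {M k i, M (Suc k) (i - 1)}"

definition cover_vertices :: "nat \<Rightarrow> vertex set" where
  "cover_vertices m = {M k i | k i. k \<le> m}"

definition cover_interior :: "nat \<Rightarrow> vertex set" where
  "cover_interior m = {M k i | k i. 0 < k \<and> k < m}"

definition cover_edges :: "nat \<Rightarrow> edge set" where
  "cover_edges m = {Straight k i | k i. k < m} \<union> {Slanted k i | k i. k < m}"

text \<open>
  Edges of the cylinder $N(m)$: the residue classes modulo \<open>n\<close> are represented by
  \<open>0, \<dots>, n - 1\<close>.  Two edges that are parallel in the cylinder (as happens for \<open>n = 1\<close>) are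
  kept apart by the constructor.
\<close>

definition cylinder_edges :: "nat \<Rightarrow> nat \<Rightarrow> edge set" where
  "cylinder_edges n m =
     {Straight k i | k i. k < m \<and> 0 \<le> i \<and> i < int n} \<union>
     {Slanted k i | k i. k < m \<and> 0 \<le> i \<and> i < int n}"

fun cover_proj :: "nat \<Rightarrow> edge \<Rightarrow> edge" where
  "cover_proj n (Straight k i) = Straight k (i mod int n)"
| "cover_proj n (Slanted k i) = Slanted k (i mod int n)"

text \<open>The \<open>n\<close>-periodic conductances on the cover induced by conductances \<open>w\<close> on the cylinder.\<close>

definition lift :: "nat \<Rightarrow> (edge \<Rightarrow> real) \<Rightarrow> edge \<Rightarrow> real" where
  "lift n w e = w (cover_proj n e)"

definition radius :: "nat \<Rightarrow> (edge \<Rightarrow> real) \<Rightarrow> nat \<Rightarrow> real" where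
  "radius n w k =
     (\<Prod>i=1..int n. lift n w (Slanted (k - 1) i)) / (\<Prod>i=1..int n. lift n w (Straight (k - 1) i))"

section \<open>The universal response matrix\<close>

definition exhaustion :: "nat \<Rightarrow> (nat \<Rightarrow> vertex set) \<Rightarrow> bool" where
  "exhaustion m V \<longleftrightarrow>
     (\<forall>N. finite (V N)) \<and> incseq V \<and> (\<Union>N. V N) = cover_vertices m"

text \<open>The response matrix of the truncation of the cover determined by the vertex set \<open>S\<close>.\<close>

definition truncated_response ::
  "nat \<Rightarrow> nat \<Rightarrow> (edge \<Rightarrow> real) \<Rightarrow> vertex set \<Rightarrow> vertex \<Rightarrow> vertex \<Rightarrow> real" where
  "truncated_response n m w S =
     response {e \<in> cover_edges m. ends e \<inter> S \<noteq> {}} ends (lift n w) (S \<inter> cover_interior m)"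

text \<open>Names for the boundary vertices: \<open>LeftB i\<close> is $i$ and \<open>RightB i\<close> is $i'$.\<close>

datatype boundary = LeftB int | RightB int

fun boundary_vertex :: "nat \<Rightarrow> boundary \<Rightarrow> vertex" where
  "boundary_vertex m (LeftB i) = M 0 i"
| "boundary_vertex m (RightB i) = M m i"

text \<open>
  A boundary vertex need not lie in the truncation for small \<open>N\<close>; it does for all large \<open>N\<close>,
  so the limit is unaffected.
\<close>

definition universal_response ::
  "nat \<Rightarrow> nat \<Rightarrow> (edge \<Rightarrow> real) \<Rightarrow> (nat \<Rightarrow> vertex set) \<Rightarrow> boundary \<Rightarrow> boundary \<Rightarrow> real" where
  "universal_response n m w V u v =
     lim (\<lambda>N. truncated_response n m w (V N) (boundary_vertex m u) (boundary_vertex m v))"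

section \<open>Polynomials in the entries of a response matrix\<close>

text \<open>
  Real polynomials in the variables $x_{uv}$: finitely supported maps from monomials to
  coefficients, a monomial being a finitely supported map from variables to exponents.
\<close>

type_synonym response_poly = "((boundary \<times> boundary) \<Rightarrow>\<^sub>0 nat) \<Rightarrow>\<^sub>0 real"

definition eval_poly :: "response_poly \<Rightarrow> (boundary \<Rightarrow> boundary \<Rightarrow> real) \<Rightarrow> real" where
  "eval_poly p X =
     (\<Sum>t\<in>Poly_Mapping.keys p. Poly_Mapping.lookup p t *
        (\<Prod>(u, v)\<in>Poly_Mapping.keys t. X u v ^ Poly_Mapping.lookup t (u, v)))"

end

theory Submission
  imports Defs "HOL-Library.Function_Algebras"
begin

text \<open>
  Since the polynomials may depend on the response matrix, what has to be shown is that the response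
  matrix determines the conductances of the first layer.  Let two networks with sorted radii have
  the same response matrix.  A harmonic function on the cover has Cauchy data, namely its boundary
  values and boundary currents.  Sorted radii force a harmonic function with finitely supported
  Cauchy data to be finitely supported, so both networks have the same Cauchy data of finitely
  supported harmonic functions; by Green's identity and linear duality they then have the same
  Cauchy data of all harmonic functions, of arbitrary growth.  The alternating function supported on
  the left boundary that solves the equations at column 1 is thus matched by a harmonic function of
  the other network with zero Cauchy data on the right.  A growth comparison, again using the order of
  the radii, shows that for one of the two networks this function is supported on the left boundary
  as well.  This yields the ratios \<open>s i / t (i + 1)\<close> and the sums \<open>s i + t i\<close>, which determine \<open>s\<close> and \<open>t\<close>
  unless the alternating function is periodic; in that case one compares the harmonic extensions of
  boundary values that exhaust the constant 1.
\<close>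

section \<open>Alternating recursions\<close>

text \<open>The alternating functions in general grow or decay exponentially, so neither bounded
  harmonic extension nor the limit behind the response matrix applies to them directly. Finitely
  supported functions are accessible from the response matrix, and since every row of the Laplacian
  is finite, duality against them needs no convergence. Sortedness enters through a comparison of
  modes. If everything on one side of a column vanishes, that column solves a homogeneous two-term
  recursion: unless it is zero it has no zeros, its signs alternate, and its factor per period is,
  up to sign, the radius of the adjacent layer, or the inverse radius when read from the right.
  Every further column is forced by the previous one. If the factors decrease along the way, later
  columns cannot cancel the mode. The order of the radii gives this towards + infinity in both
  reading directions; towards - infinity the comparison fails. It is not known in advance in which
  network the transferred mode stays on the left boundary. If it did so in neither, each mode would
  dominate the other, which is impossible.\<close>

definition alt :: "int \<Rightarrow> real" where
  "alt i = (if even i then 1 else - 1)"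

lemma alt_add_1 [simp]: "alt (i + 1) = - alt i" "alt (1 + i) = - alt i"
  and alt_diff_1 [simp]: "alt (i - 1) = - alt i"
  and alt_square [simp]: "alt i * alt i = 1" "alt i * (alt i * x) = x"
  and alt_nonzero [simp]: "alt i \<noteq> 0"
  and abs_alt [simp]: "\<bar>alt i\<bar> = 1"
  by (auto simp: alt_def)

section \<open>Two-sided first-order recursions and periodic coefficients\<close>

lemma int_recursion_exists:
  fixes g :: "int \<Rightarrow> real"
  assumes "\<And>l. g l > 0"
  obtains H where "\<And>l. H l > 0" "\<And>l. H (l + 1) = g l * H l"
proof
  define H where "H l = (if l \<ge> 0 then \<Prod>j\<in>{0..<l}. g j else inverse (\<Prod>j\<in>{l..<0}. g j))" for l
  show "H l > 0" for l
    using assms by (auto simp: H_def intro!: prod_pos)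
  show "H (l + 1) = g l * H l" for l
  proof (cases "l \<ge> 0")
    case True
    then have "{0..<l + 1} = insert l {0..<l}" by auto
    with True show ?thesis by (simp add: H_def)
  next
    case False
    then have "{l..<0} = insert l {l + 1..<0}" by auto
    moreover have "g l \<noteq> 0" using assms[of l] by simp
    ultimately show ?thesis using False by (auto simp: H_def)
  qed
qed

lemma int_shift_invariant:
  fixes f :: "int \<Rightarrow> 'a"
  assumes "\<And>l. l \<ge> l0 \<Longrightarrow> f (l + 1) = f l" and "l \<ge> l0"
  shows "f l = f l0"
  using assms(2)
  by (induction rule: int_ge_induct) (use assms(1) in auto)

lemma int_shift_invariant_le:
  fixes f :: "int \<Rightarrow> 'a"
  assumes "\<And>l. l < l0 \<Longrightarrow> f (l + 1) = f l" and "l \<le> l0"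
  shows "f l = f l0"
  using assms(2)
proof (induction rule: int_le_induct)
  case base
  show ?case ..
next
  case (step i)
  with assms(1)[of "i - 1"] show ?case by simp
qed

lemma int_shift_invariant_all:
  fixes f :: "int \<Rightarrow> 'a"
  assumes "\<And>l. f (l + 1) = f l"
  shows "f l = f l'"
  using int_shift_invariant[of l' f l] int_shift_invariant_le[of l' f l] assms
  by (cases "l \<ge> l'") auto

lemma periodic_multiple:
  fixes f :: "int \<Rightarrow> 'a"
  assumes "\<And>i. f (i + int n) = f i"
  shows "f (i + int n * k) = f i"
proof -
  have pos: "f (i + int n * int j) = f i" for i j
  proof (induction j)
    case (Suc j)
    then show ?case
      using assms[of "i + int n * int j"] by (simp add: algebra_simps)
  qed simp
  show ?thesis
  proof (cases "k \<ge> 0")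
    case True
    then show ?thesis using pos[of i "nat k"] by simp
  next
    case False
    then show ?thesis using pos[of "i + int n * k" "nat (- k)"] by simp
  qed
qed

lemma periodic_mod:
  fixes f :: "int \<Rightarrow> 'a"
  assumes "\<And>i. f (i + int n) = f i"
  shows "f (i mod int n) = f i"
  using periodic_multiple[of f n "i mod int n" "i div int n", OF assms]
  by (simp add: add.commute)

lemma prod_period_int:
  fixes g :: "int \<Rightarrow> real"
  assumes per: "\<And>i. g (i + int n) = g i"
  shows "(\<Prod>j\<in>{a..<a + int n}. g j) = (\<Prod>j\<in>{b..<b + int n}. g j)"
proof (cases "n = 0")
  case False
  have "(\<Prod>j\<in>{a + 1..<a + 1 + int n}. g j) = (\<Prod>j\<in>{a..<a + int n}. g j)" for a
  proof -
    have 1: "{a + 1..<a + 1 + int n} = insert (a + int n) {a + 1..<a + int n}"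
      and 2: "{a..<a + int n} = insert a {a + 1..<a + int n}"
      using False by auto
    show ?thesis unfolding 1 2 by (simp add: per)
  qed
  then show ?thesis
    by (rule int_shift_invariant_all[where f = "\<lambda>a. \<Prod>j\<in>{a..<a + int n}. g j"])
qed simp

text \<open>The product over one period is the Floquet multiplier of the recursion; periodicity of
  \<open>g\<close> makes it independent of the window, so \<open>a\<close> is free.\<close>

lemma multiplier_period:
  fixes H :: "int \<Rightarrow> real"
  assumes per: "\<And>i. g (i + int n) = g i"
    and pos: "\<And>l. H l > 0"
    and rec: "\<And>l. H (l + 1) = g l * H l"
  shows "H (l + int n) = (\<Prod>j\<in>{a..<a + int n}. g j) * H l"
proof -
  have "H (l + int N) = (\<Prod>j\<in>{l..<l + int N}. g j) * H l" for N
  proof (induction N)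
    case (Suc N)
    have "{l..<l + int (Suc N)} = insert (l + int N) {l..<l + int N}" by auto
    with Suc rec[of "l + int N"] show ?case by (simp add: algebra_simps)
  qed simp
  then show ?thesis
    using prod_period_int[of g n l a, OF per] by simp
qed

text \<open>The minimum over one window of length \<open>n\<close> works. Growth along shifts by
  \<open>n\<close>, rather than periodicity, is what a quotient of two modes with different
  multipliers satisfies.\<close>

lemma periodic_positive_lower_bound:
  fixes r :: "int \<Rightarrow> real"
  assumes n: "n \<ge> 1" and pos: "\<And>l. r l > 0" and mono: "\<And>l. r (l + int n) \<ge> r l"
  obtains c where "c > 0" "\<And>l. l \<ge> l0 \<Longrightarrow> r l \<ge> c"
proof
  define c where "c = Min (r ` {l0..<l0 + int n})"
  have ne: "{l0..<l0 + int n} \<noteq> {}" using n by auto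
  show "c > 0" unfolding c_def using pos ne by auto
  have step: "r (l + int n * int k) \<ge> r l" for l k
  proof (induction k)
    case (Suc k)
    then show ?case
      using mono[of "l + int n * int k"] by (simp add: algebra_simps)
  qed simp
  show "r l \<ge> c" if "l \<ge> l0" for l
  proof -
    define k where "k = (l - l0) div int n"
    have k: "k \<ge> 0" using that n by (simp add: k_def pos_imp_zdiv_nonneg_iff)
    have lk: "l - int n * k = l0 + (l - l0) mod int n"
      by (simp add: k_def algebra_simps minus_div_mult_eq_mod [symmetric])
    have mem: "l - int n * k \<in> {l0..<l0 + int n}"
      unfolding lk using n by simp
    then have "c \<le> r (l - int n * k)" unfolding c_def by auto
    also have "\<dots> \<le> r l" using step[of "l - int n * k" "nat k"] k by simp
    finally show ?thesis .
  qed
qed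

text \<open>Asking for every constant, not just for some positive one, makes the relation asymmetric
  on positive functions; this asymmetry later decides between two networks.\<close>

definition dominates :: "(int \<Rightarrow> real) \<Rightarrow> (int \<Rightarrow> real) \<Rightarrow> bool" where
  "dominates f g \<longleftrightarrow> (\<forall>C. \<exists>l0. \<forall>l\<ge>l0. f l \<ge> C * g l)"

text \<open>
  Each \<open>Y (p + 1)\<close> is forced by \<open>Y p\<close>, and the multipliers \<open>\<rho>\<close> are decreasing, so the forcing term is at
  least comparable with the homogeneous solution \<open>H (p + 1)\<close>; even in the resonant case
  \<open>\<rho> (p + 1) = \<rho> p\<close> the quotient \<open>Y (p + 1) / H (p + 1)\<close> grows linearly.  The term with a negative
  sign is absorbed by \<open>Y p l \<ge> Y (p - 1) (l - 1)\<close>.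
\<close>

lemma alternating_growth:
  fixes \<alpha> \<beta> Y H :: "nat \<Rightarrow> int \<Rightarrow> real"
  assumes n: "n \<ge> 1"
    and pos: "\<And>p l. p \<le> q \<Longrightarrow> \<alpha> p l > 0 \<and> \<beta> p l > 0"
    and H_pos: "\<And>p l. p \<le> q \<Longrightarrow> H p l > 0"
    and H_rec: "\<And>p l. p \<le> q \<Longrightarrow> \<alpha> p (l + 1) * H p (l + 1) = \<beta> p l * H p l"
    and H_per: "\<And>p l. p \<le> q \<Longrightarrow> H p (l + int n) = \<rho> p * H p l"
    and sorted: "\<And>p. p < q \<Longrightarrow> \<rho> (Suc p) \<le> \<rho> p"
    and base: "cb > 0" "\<And>l. l \<ge> lb \<Longrightarrow> Y 0 l \<ge> cb * H 0 l"
    and rec: "\<And>p l. p < q \<Longrightarrow> l \<ge> lb \<Longrightarrow>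
      \<alpha> (Suc p) (l + 1) * Y (Suc p) (l + 1) - \<beta> (Suc p) l * Y (Suc p) l =
        (\<alpha> (Suc p) (l + 1) + \<beta> (Suc p) l + \<alpha> p l + \<beta> p l) * Y p l
        + (if p = 0 then 0 else \<beta> p l * Y (p - 1) l - \<alpha> p l * Y (p - 1) (l - 1))"
    and p: "1 \<le> p" "p \<le> q"
  shows "dominates (Y p) (H p)"
proof -
  \<comment> \<open>The induction carries a lower bound with some \<open>c > 0\<close>, because
    column 0 is only comparable to its mode and does not dominate it. The shifted comparison of
    neighbouring columns is what controls the negative term one column later.\<close>
  have main: "p \<le> q \<Longrightarrow> (\<exists>c>0. \<exists>L\<ge>lb. (\<forall>l\<ge>L. Y p l \<ge> c * H p l) \<and>
      (p > 0 \<longrightarrow> (\<forall>l\<ge>L. Y p l \<ge> Y (p - 1) (l - 1) \<and> Y (p - 1) l \<ge> 0)))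
     \<and> (p > 0 \<longrightarrow> dominates (Y p) (H p))" for p
  proof (induction p)
    case 0
    then show ?case using base by auto
  next
    case (Suc p)
    then have pq: "p < q" "p \<le> q" by auto
    from Suc.IH[OF pq(2)] obtain c L where c: "c > 0" "L \<ge> lb" and Y: "\<And>l. l \<ge> L \<Longrightarrow> Y p l \<ge> c * H p l"
      and YY: "\<And>l. p > 0 \<Longrightarrow> l \<ge> L \<Longrightarrow> Y p l \<ge> Y (p - 1) (l - 1) \<and> Y (p - 1) l \<ge> 0"
      by blast
    have Yp: "Y p l > 0" if "l \<ge> L" for l
      using Y[OF that] c(1) H_pos[OF pq(2), of l] by (smt (verit) mult_pos_pos)
    \<comment> \<open>Of the forcing only \<open>\<alpha> (Suc p) (l + 1) * Y p l\<close> is kept: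
      \<open>\<alpha> p l * Y p l\<close> pays for the negative term, and the rest is
      nonnegative.\<close>
    have lower: "\<alpha> (Suc p) (l + 1) * Y (Suc p) (l + 1) \<ge>
        \<beta> (Suc p) l * Y (Suc p) l + \<alpha> (Suc p) (l + 1) * Y p l" if "l \<ge> L" for l
    proof -
      have "\<alpha> p l * Y p l + (if p = 0 then 0 else \<beta> p l * Y (p - 1) l - \<alpha> p l * Y (p - 1) (l - 1)) \<ge> 0"
      proof (cases "p = 0")
        case True
        then show ?thesis using Yp[OF that] pos[OF pq(2), of l] by simp
      next
        case False
        then have "\<alpha> p l * Y p l \<ge> \<alpha> p l * Y (p - 1) (l - 1)" "\<beta> p l * Y (p - 1) l \<ge> 0"
          using YY[of l] that pos[OF pq(2), of l] by auto
        then show ?thesis using False by simp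
      qed
      moreover have "\<beta> (Suc p) l * Y p l \<ge> 0" "\<beta> p l * Y p l \<ge> 0"
        using Yp[OF that] pos[OF pq(2), of l] pos[OF Suc.prems, of l] by auto
      ultimately show ?thesis
        using rec[of p l] that c(2) pq(1) by (simp add: algebra_simps)
    qed
    \<comment> \<open>Sortedness enters here: one period multiplies this quotient by
      \<open>\<rho> p / \<rho> (Suc p)\<close>, which is at least 1.\<close>
    have ratio_mono: "H p (l + int n) / H (Suc p) (l + int n + 1) \<ge> H p l / H (Suc p) (l + 1)" for l
    proof -
      have pp: "H p l > 0" "H (Suc p) (l + 1) > 0" "H p (l + int n) > 0" "H (Suc p) (l + 1 + int n) > 0"
        using H_pos pq Suc.prems by blast+
      have r: "\<rho> (Suc p) > 0" "\<rho> p > 0"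
        using H_per[OF pq(2), of l] H_per[OF Suc.prems, of "l + 1"] pp
        by (simp_all add: zero_less_mult_iff)
      have e: "H (Suc p) (l + int n + 1) = \<rho> (Suc p) * H (Suc p) (l + 1)"
        using H_per[OF Suc.prems, of "l + 1"] by (simp add: algebra_simps)
      show ?thesis
        unfolding e H_per[OF pq(2)] using r pp sorted[OF pq(1)]
        by (simp add: field_simps mult_right_mono)
    qed
    obtain c1 where c1: "c1 > 0" "\<And>l. l \<ge> L \<Longrightarrow> H p l / H (Suc p) (l + 1) \<ge> c1"
      by (rule periodic_positive_lower_bound[OF n, of "\<lambda>l. H p l / H (Suc p) (l + 1)" L])
        (use ratio_mono H_pos pq Suc.prems in \<open>auto simp: algebra_simps\<close>)
    \<comment> \<open>Variation of constants: relative to its own mode, column \<open>Suc p\<close>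
      gains at least \<open>c * c1\<close> at every index, hence grows at least linearly.\<close>
    define \<psi> where "\<psi> l = Y (Suc p) l / H (Suc p) l" for l
    have \<psi>_step: "\<psi> (l + 1) \<ge> \<psi> l + c * c1" if "l \<ge> L" for l
    proof -
      have h: "H (Suc p) (l + 1) > 0" "H (Suc p) l > 0" "\<alpha> (Suc p) (l + 1) > 0"
        using H_pos pos Suc.prems by auto
      have "c * c1 * H (Suc p) (l + 1) \<le> c * H p l"
        using c1(2)[OF that] h c(1) by (simp add: field_simps)
      also have "\<dots> \<le> Y p l" by (rule Y[OF that])
      finally have 1: "c * c1 * H (Suc p) (l + 1) \<le> Y p l" .
      have "\<beta> (Suc p) l * Y (Suc p) l = \<beta> (Suc p) l * H (Suc p) l * \<psi> l"
        using h by (simp add: \<psi>_def)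
      also have "\<dots> = \<alpha> (Suc p) (l + 1) * (H (Suc p) (l + 1) * \<psi> l)"
        by (simp add: H_rec[OF Suc.prems, symmetric])
      finally have "\<alpha> (Suc p) (l + 1) * Y (Suc p) (l + 1) \<ge>
          \<alpha> (Suc p) (l + 1) * (H (Suc p) (l + 1) * \<psi> l + Y p l)"
        using lower[OF that] by (simp add: algebra_simps)
      then have "Y (Suc p) (l + 1) \<ge> H (Suc p) (l + 1) * \<psi> l + Y p l"
        using h by simp
      with 1 have "Y (Suc p) (l + 1) \<ge> H (Suc p) (l + 1) * (\<psi> l + c * c1)"
        by (simp add: algebra_simps)
      then show ?thesis using h by (simp add: \<psi>_def field_simps)
    qed
    have \<psi>_ge: "\<psi> l \<ge> \<psi> L + c * c1 * real_of_int (l - L)" if "l \<ge> L" for l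
      using that
    proof (induction rule: int_ge_induct)
      case (step i)
      then show ?case using \<psi>_step[of i] by (simp add: algebra_simps)
    qed simp
    have dom: "\<exists>l1\<ge>L. \<forall>l\<ge>l1. Y (Suc p) l \<ge> C * H (Suc p) l" for C
    proof -
      define l1 where "l1 = max L (L + \<lceil>(C - \<psi> L) / (c * c1)\<rceil>)"
      have "Y (Suc p) l \<ge> C * H (Suc p) l" if "l \<ge> l1" for l
      proof -
        have cc: "c * c1 > 0" using c c1 by simp
        have "l \<ge> L" "l \<ge> L + \<lceil>(C - \<psi> L) / (c * c1)\<rceil>" using that by (auto simp: l1_def)
        then have "(C - \<psi> L) / (c * c1) \<le> real_of_int (l - L)" by linarith
        then have "C - \<psi> L \<le> c * c1 * real_of_int (l - L)"
          using cc by (simp add: pos_divide_le_eq mult.commute)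
        with \<psi>_ge[OF \<open>l \<ge> L\<close>] have "\<psi> l \<ge> C" by simp
        then show ?thesis using H_pos[OF Suc.prems, of l] by (simp add: \<psi>_def field_simps)
      qed
      then show ?thesis by (intro exI[of _ l1]) (auto simp: l1_def)
    qed
    then have "dominates (Y (Suc p)) (H (Suc p))"
      unfolding dominates_def by blast
    moreover from dom[of 1] obtain L1 where L1: "L1 \<ge> L" "\<And>l. l \<ge> L1 \<Longrightarrow> Y (Suc p) l \<ge> H (Suc p) l"
      by auto
    have "Y (Suc p) l \<ge> Y p (l - 1) \<and> Y p l \<ge> 0" if "l \<ge> L1 + 1" for l
    proof -
      have "\<beta> (Suc p) (l - 1) * Y (Suc p) (l - 1) \<ge> 0"
        using L1(2)[of "l - 1"] that pos[OF Suc.prems, of "l - 1"] H_pos[OF Suc.prems, of "l - 1"] by auto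
      then have "\<alpha> (Suc p) l * Y (Suc p) l \<ge> \<alpha> (Suc p) l * Y p (l - 1)"
        using lower[of "l - 1"] that L1(1) by simp
      then show ?thesis using pos[OF Suc.prems, of l] Yp[of l] that L1(1) by simp
    qed
    ultimately show ?case
      using L1 c(2) by (intro conjI impI exI[of _ 1] exI[of _ "L1 + 1"]) auto
  qed
  show ?thesis using main[OF p(2)] p(1) by simp
qed

text \<open>The modes of the columns before \<open>q\<close> are determined up to a positive factor
  and can be constructed; only the last one, which the conclusion mentions, is prescribed. Their
  multipliers become products over one period, and a homogeneous, somewhere positive column 0 is
  automatically a positive multiple of its mode.\<close>

lemma alternating_growth_mode:
  fixes \<alpha> \<beta> Y :: "nat \<Rightarrow> int \<Rightarrow> real"
  assumes n: "n \<ge> 1" and q: "q \<ge> 1"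
    and pos: "\<And>p l. p \<le> q \<Longrightarrow> \<alpha> p l > 0 \<and> \<beta> p l > 0"
    and per: "\<And>p l. p \<le> q \<Longrightarrow> \<alpha> p (l + int n) = \<alpha> p l \<and> \<beta> p (l + int n) = \<beta> p l"
    and sorted: "\<And>p. p < q \<Longrightarrow> (\<Prod>j\<in>{0..<int n}. \<beta> (Suc p) j / \<alpha> (Suc p) (j + 1))
      \<le> (\<Prod>j\<in>{0..<int n}. \<beta> p j / \<alpha> p (j + 1))"
    and base: "Y 0 lb > 0" "\<And>l. l \<ge> lb \<Longrightarrow> \<alpha> 0 (l + 1) * Y 0 (l + 1) = \<beta> 0 l * Y 0 l"
    and rec: "\<And>p l. p < q \<Longrightarrow> l \<ge> lb \<Longrightarrow>
      \<alpha> (Suc p) (l + 1) * Y (Suc p) (l + 1) - \<beta> (Suc p) l * Y (Suc p) l =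
        (\<alpha> (Suc p) (l + 1) + \<beta> (Suc p) l + \<alpha> p l + \<beta> p l) * Y p l
        + (if p = 0 then 0 else \<beta> p l * Y (p - 1) l - \<alpha> p l * Y (p - 1) (l - 1))"
    and H: "\<And>l. H l > 0" "\<And>l. \<alpha> q (l + 1) * H (l + 1) = \<beta> q l * H l"
  shows "dominates (Y q) H"
proof -
  have "\<exists>h. (\<forall>l. h l > 0) \<and> (\<forall>l. \<alpha> p (l + 1) * h (l + 1) = \<beta> p l * h l)" if pq: "p \<le> q" for p
  proof -
    obtain h where h: "\<And>l. h l > 0" "\<And>l. h (l + 1) = (\<beta> p l / \<alpha> p (l + 1)) * h l"
      using int_recursion_exists[of "\<lambda>l. \<beta> p l / \<alpha> p (l + 1)"] pos[OF pq]
      by (metis divide_pos_pos)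
    have "\<alpha> p (l + 1) * h (l + 1) = \<beta> p l * h l" for l
      using pos[OF pq, of "l + 1"] by (simp add: h(2))
    with h(1) show ?thesis by blast
  qed
  then obtain K' where K': "\<And>p l. p \<le> q \<Longrightarrow> K' p l > 0"
    "\<And>p l. p \<le> q \<Longrightarrow> \<alpha> p (l + 1) * K' p (l + 1) = \<beta> p l * K' p l"
    by metis
  define K where "K p = (if p = q then H else K' p)" for p
  have K: "K p l > 0" "\<alpha> p (l + 1) * K p (l + 1) = \<beta> p l * K p l" if "p \<le> q" for p l
    using K' H that by (auto simp: K_def)
  have K_per: "K p (l + int n) = (\<Prod>j\<in>{0..<int n}. \<beta> p j / \<alpha> p (j + 1)) * K p l" if "p \<le> q" for p l
  proof -
    have "K p (l + int n) = (\<Prod>j\<in>{0..<0 + int n}. \<beta> p j / \<alpha> p (j + 1)) * K p l"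
    proof (rule multiplier_period)
      fix i
      show "\<beta> p (i + int n) / \<alpha> p (i + int n + 1) = \<beta> p i / \<alpha> p (i + 1)"
        using per[OF that, of i] per[OF that, of "i + 1"] by (simp add: algebra_simps)
    next
      fix l
      show "K p (l + 1) = \<beta> p l / \<alpha> p (l + 1) * K p l"
        using K(2)[OF that, of l] pos[OF that, of "l + 1"] by (simp add: field_simps)
    qed (use K(1) that in auto)
    then show ?thesis by simp
  qed
  have Y0: "Y 0 l = Y 0 lb / K 0 lb * K 0 l" if "l \<ge> lb" for l
  proof -
    have "Y 0 (l + 1) / K 0 (l + 1) = Y 0 l / K 0 l" if "l \<ge> lb" for l
    proof -
      have "\<alpha> 0 (l + 1) > 0" "\<beta> 0 l > 0" "K 0 l > 0" "K 0 (l + 1) > 0"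
        using pos[of 0] K(1)[of 0] by auto
      moreover have "\<alpha> 0 (l + 1) * Y 0 (l + 1) * (\<beta> 0 l * K 0 l) =
          \<beta> 0 l * Y 0 l * (\<alpha> 0 (l + 1) * K 0 (l + 1))"
        using base(2)[OF that] K(2)[of 0 l] by simp
      ultimately show ?thesis by (simp add: field_simps)
    qed
    then have "Y 0 l / K 0 l = Y 0 lb / K 0 lb"
      using int_shift_invariant[of lb "\<lambda>l. Y 0 l / K 0 l" l] that by blast
    moreover have "K 0 l > 0" using K(1)[of 0] by simp
    ultimately show ?thesis by (simp add: field_simps)
  qed
  have "dominates (Y q) (K q)"
  proof (rule alternating_growth[where cb = "Y 0 lb / K 0 lb" and lb = lb and q = q and p = q and
          \<rho> = "\<lambda>p. \<Prod>j\<in>{0..<int n}. \<beta> p j / \<alpha> p (j + 1)" and \<alpha> = \<alpha> and \<beta> = \<beta>, OF n])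
    show "Y 0 lb / K 0 lb > 0" using base(1) K(1)[of 0 lb] by simp
    show "Y 0 l \<ge> Y 0 lb / K 0 lb * K 0 l" if "l \<ge> lb" for l
      using Y0[OF that] by simp
  qed (fact pos K K_per sorted rec q order.refl | assumption)+
  then show ?thesis by (simp add: K_def)
qed

section \<open>Harmonic functions on the cover\<close>

text \<open>The Kirchhoff matrix as a local operator, so that it applies to functions of infinite
  support and arbitrary growth. On columns 0 and \<open>m\<close> its values are the boundary
  currents; beyond column \<open>m\<close> it is 0.\<close>

definition lap :: "nat \<Rightarrow> (edge \<Rightarrow> real) \<Rightarrow> (vertex \<Rightarrow> real) \<Rightarrow> vertex \<Rightarrow> real" where
  "lap m W f x = (case x of M k i \<Rightarrow>
     (if k < m then W (Straight k i) * (f (M (Suc k) i) - f x)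
        + W (Slanted k i) * (f (M (Suc k) (i - 1)) - f x) else 0)
   + (if 0 < k \<and> k \<le> m then W (Straight (k - 1) i) * (f (M (k - 1) i) - f x)
        + W (Slanted (k - 1) (i + 1)) * (f (M (k - 1) (i + 1)) - f x) else 0))"

definition harmonic :: "nat \<Rightarrow> (edge \<Rightarrow> real) \<Rightarrow> (vertex \<Rightarrow> real) \<Rightarrow> bool" where
  "harmonic m W f \<longleftrightarrow> (\<forall>x\<in>cover_interior m. lap m W f x = 0)"

lemma harmonicD: "harmonic m W f \<Longrightarrow> 0 < k \<Longrightarrow> k < m \<Longrightarrow> lap m W f (M k i) = 0"
  by (auto simp: harmonic_def cover_interior_def)

locale strip =
  fixes n m :: nat and W :: "edge \<Rightarrow> real"
  assumes n_pos: "n \<ge> 1" and m_pos: "m \<ge> 1"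
    and straight_pos: "\<And>k i. k < m \<Longrightarrow> W (Straight k i) > 0"
    and slanted_pos: "\<And>k i. k < m \<Longrightarrow> W (Slanted k i) > 0"
    and straight_periodic: "\<And>k i. W (Straight k (i + int n)) = W (Straight k i)"
    and slanted_periodic: "\<And>k i. W (Slanted k (i + int n)) = W (Slanted k i)"
begin

abbreviation s :: "nat \<Rightarrow> int \<Rightarrow> real" where "s k i \<equiv> W (Straight k i)"
abbreviation t :: "nat \<Rightarrow> int \<Rightarrow> real" where "t k i \<equiv> W (Slanted k i)"

text \<open>Layers are counted from 0 here, so \<open>layer_radius k\<close> is $R_{k+1}$.\<close>

definition layer_radius :: "nat \<Rightarrow> real" where
  "layer_radius k = (\<Prod>j\<in>{0..<int n}. t k j) / (\<Prod>j\<in>{0..<int n}. s k j)"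

lemma layer_radius_shift:
  "(\<Prod>j\<in>{0..<int n}. t k (j + a) / s k (j + b)) = layer_radius k"
  "(\<Prod>j\<in>{0..<int n}. s k (j + a) / t k (j + b)) = inverse (layer_radius k)"
proof -
  have sh: "(\<Prod>j\<in>{0..<int n}. g (j + a)) = (\<Prod>j\<in>{0..<int n}. g j)"
    if "\<And>i. g (i + int n) = g i" for g :: "int \<Rightarrow> real" and a
  proof -
    have "(\<Prod>j\<in>{0..<int n}. g (j + a)) = (\<Prod>j\<in>{a..<a + int n}. g j)"
      by (rule prod.reindex_bij_witness[where i = "\<lambda>j. j - a" and j = "\<lambda>j. j + a"]) auto
    also have "\<dots> = (\<Prod>j\<in>{0..<0 + int n}. g j)"
      by (rule prod_period_int) (rule that)
    finally show ?thesis by simp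
  qed
  show "(\<Prod>j\<in>{0..<int n}. t k (j + a) / s k (j + b)) = layer_radius k"
    "(\<Prod>j\<in>{0..<int n}. s k (j + a) / t k (j + b)) = inverse (layer_radius k)"
    using sh[of "t k"] sh[of "s k"] slanted_periodic straight_periodic
    by (simp_all add: prod_dividef layer_radius_def)
qed

lemma layer_radius_pos: "k < m \<Longrightarrow> layer_radius k > 0"
  unfolding layer_radius_def by (intro divide_pos_pos prod_pos) (auto simp: straight_pos slanted_pos)

definition sorted_radii :: bool where
  "sorted_radii \<longleftrightarrow> (\<forall>k. Suc k < m \<longrightarrow> layer_radius (Suc k) \<le> layer_radius k)"

lemma lap_left:
  "lap m W f (M 0 i) = s 0 i * (f (M 1 i) - f (M 0 i)) + t 0 i * (f (M 1 (i - 1)) - f (M 0 i))"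
  using m_pos by (simp add: lap_def)

lemma lap_Suc:
  "Suc k < m \<Longrightarrow> lap m W f (M (Suc k) i) =
     s (Suc k) i * (f (M (Suc (Suc k)) i) - f (M (Suc k) i))
   + t (Suc k) i * (f (M (Suc (Suc k)) (i - 1)) - f (M (Suc k) i))
   + (s k i * (f (M k i) - f (M (Suc k) i)) + t k (i + 1) * (f (M k (i + 1)) - f (M (Suc k) i)))"
  by (simp add: lap_def)

lemma lap_shift: "lap m W (\<lambda>x. case x of M k i \<Rightarrow> f (M k (i + int n * a))) (M k i) = lap m W f (M k (i + int n * a))"
  using periodic_multiple[of "\<lambda>i. s _ i" n, OF straight_periodic]
    periodic_multiple[of "\<lambda>i. t _ i" n, OF slanted_periodic, of _ _ a]
    periodic_multiple[of "\<lambda>i. t (k - 1) i" n "i + 1" a, OF slanted_periodic]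
  by (simp add: lap_def algebra_simps)

text \<open>Induction on the column. If the columns up to \<open>k\<close> vanish far up, column
  \<open>k + 1\<close> solves a homogeneous two-term recursion there. Were it nonzero at one index,
  its alternating mode would force the following columns to grow, and column \<open>m\<close> could
  not be zero far up.\<close>

lemma vanishes_upwards:
  assumes sorted: sorted_radii and u: "harmonic m W u"
    and left: "\<And>i. i \<ge> i0 \<Longrightarrow> u (M 0 i) = 0" "\<And>i. i \<ge> i0 \<Longrightarrow> lap m W u (M 0 i) = 0"
    and right: "\<And>i. i \<ge> i0 \<Longrightarrow> u (M m i) = 0"
    and "k \<le> m"
  shows "\<exists>i1. \<forall>i\<ge>i1. \<forall>j\<le>k. u (M j i) = 0"
  using \<open>k \<le> m\<close>
proof (induction k)
  case 0
  then show ?case using left(1) by auto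
next
  case (Suc k)
  then obtain i1 where i1: "\<And>i j. i \<ge> i1 \<Longrightarrow> j \<le> k \<Longrightarrow> u (M j i) = 0" by auto
  define i2 where "i2 = max i0 i1"
  have km: "k < m" using Suc.prems by simp
  have lap0: "lap m W u (M j i) = 0" if "i \<ge> i2" "j < m" for i j
    using that left(2) harmonicD[OF u, of j i] by (cases "j = 0") (auto simp: i2_def)
  have kernel: "s k i * u (M (Suc k) i) + t k i * u (M (Suc k) (i - 1)) = 0" if "i \<ge> i2" for i
  proof -
    have z: "u (M k i) = 0" "u (M (k - 1) i) = 0" "u (M (k - 1) (i + 1)) = 0"
      using i1[of i] i1[of "i + 1"] that by (auto simp: i2_def)
    from lap0[OF that km] show ?thesis
      using km z by (auto simp: lap_def split: if_splits)
  qed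
  show ?case
  proof (cases "\<exists>l\<ge>i2. u (M (Suc k) l) \<noteq> 0")
    case False
    then show ?thesis using i1 by (intro exI[of _ i2]) (auto simp: le_Suc_eq i2_def)
  next
    case True
    then obtain l where l: "l \<ge> i2" "u (M (Suc k) l) \<noteq> 0" by auto
    define q where "q = m - Suc k"
    have q: "q \<ge> 1"
    proof (rule ccontr)
      assume "\<not> q \<ge> 1"
      then have "Suc k = m" using km by (simp add: q_def)
      with right[of l] l show False by (auto simp: i2_def)
    qed
    \<comment> \<open>A shear: slanted edges lower the index by one per column. In the coordinate
      \<open>j = i + p\<close> the right neighbours of a vertex have coordinates
      \<open>j + 1\<close> (straight) and \<open>j\<close> (slanted), as the growth lemma expects.
      The sign \<open>\<epsilon>\<close> makes the starting value positive.\<close>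
    define \<alpha> \<beta> where "\<alpha> p j = s (k + p) (j - int p)" and "\<beta> p j = t (k + p) (j - int p + 1)" for p j
    define \<epsilon> where "\<epsilon> = sgn (alt l * u (M (Suc k) l))"
    define Y where "Y p j = \<epsilon> * alt (j - int p) * u (M (Suc k + p) (j - int p))" for p j
    have \<alpha>\<beta>_pos: "\<alpha> p j > 0" "\<beta> p j > 0" if "p \<le> q" for p j
      using that straight_pos[of "k + p"] slanted_pos[of "k + p"] km by (auto simp: \<alpha>_def \<beta>_def q_def)
    obtain H where H: "\<And>l. H l > 0" "\<And>l. H (l + 1) = (\<beta> q l / \<alpha> q (l + 1)) * H l"
      by (rule int_recursion_exists[of "\<lambda>l. \<beta> q l / \<alpha> q (l + 1)"])
        (use \<alpha>\<beta>_pos in auto)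
    have "dominates (Y q) H"
    proof (rule alternating_growth_mode[where \<alpha> = \<alpha> and \<beta> = \<beta> and n = n and lb = l])
      show "n \<ge> 1" by (rule n_pos)
      show "q \<ge> 1" by (rule q)
      show "\<alpha> p j > 0 \<and> \<beta> p j > 0" if "p \<le> q" for p j
        using \<alpha>\<beta>_pos that by blast
      show "\<alpha> p (j + int n) = \<alpha> p j \<and> \<beta> p (j + int n) = \<beta> p j" if "p \<le> q" for p j
        using straight_periodic[of "k + p" "j - int p"] slanted_periodic[of "k + p" "j - int p + 1"]
        by (simp add: \<alpha>_def \<beta>_def algebra_simps)
      have "(\<Prod>j\<in>{0..<int n}. \<beta> p j / \<alpha> p (j + 1)) = layer_radius (k + p)" for p
        using layer_radius_shift(1)[of "k + p" "1 - int p" "1 - int p"]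
        by (simp add: \<alpha>_def \<beta>_def algebra_simps)
      then show "(\<Prod>j\<in>{0..<int n}. \<beta> (Suc p) j / \<alpha> (Suc p) (j + 1))
          \<le> (\<Prod>j\<in>{0..<int n}. \<beta> p j / \<alpha> p (j + 1))" if "p < q" for p
        using sorted that km by (simp add: sorted_radii_def q_def)
      have "Y 0 l = \<bar>alt l * u (M (Suc k) l)\<bar>"
        by (simp add: Y_def \<epsilon>_def abs_sgn mult_ac)
      then show "Y 0 l > 0" using l(2) by simp
      show "\<alpha> 0 (j + 1) * Y 0 (j + 1) = \<beta> 0 j * Y 0 j" if "j \<ge> l" for j
      proof -
        have "\<epsilon> * alt j * (s k (j + 1) * u (M (Suc k) (j + 1)) + t k (j + 1) * u (M (Suc k) j)) = 0"
          using kernel[of "j + 1"] that l(1) by simp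
        then show ?thesis by (simp add: \<alpha>_def \<beta>_def Y_def algebra_simps)
      qed
      show "\<alpha> (Suc p) (j + 1) * Y (Suc p) (j + 1) - \<beta> (Suc p) j * Y (Suc p) j =
        (\<alpha> (Suc p) (j + 1) + \<beta> (Suc p) j + \<alpha> p j + \<beta> p j) * Y p j
        + (if p = 0 then 0 else \<beta> p j * Y (p - 1) j - \<alpha> p j * Y (p - 1) (j - 1))"
        if "p < q" "j \<ge> l" for p j
      proof -
        define i where "i = j - int p"
        have j: "j = i + int p" by (simp add: i_def)
        have c: "Suc (k + p) < m" using that(1) by (simp add: q_def)
        have "\<epsilon> * alt i * lap m W u (M (Suc (k + p)) i) = 0"
          using harmonicD[OF u _ c] by simp
        then have main: "s (Suc (k + p)) i * (\<epsilon> * alt i * u (M (Suc (Suc (k + p))) i))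
            + t (Suc (k + p)) i * (\<epsilon> * alt i * u (M (Suc (Suc (k + p))) (i - 1)))
            + s (k + p) i * (\<epsilon> * alt i * u (M (k + p) i))
            + t (k + p) (i + 1) * (\<epsilon> * alt i * u (M (k + p) (i + 1)))
            = (s (Suc (k + p)) i + t (Suc (k + p)) i + s (k + p) i + t (k + p) (i + 1))
              * (\<epsilon> * alt i * u (M (Suc (k + p)) i))"
          unfolding lap_Suc[OF c] by (simp add: algebra_simps)
        have coeffs: "\<alpha> (Suc p) (j + 1) = s (Suc (k + p)) i" "\<beta> (Suc p) j = t (Suc (k + p)) i"
          "\<alpha> p j = s (k + p) i" "\<beta> p j = t (k + p) (i + 1)"
          by (simp_all add: \<alpha>_def \<beta>_def i_def)
        have Y: "Y (Suc p) (j + 1) = \<epsilon> * alt i * u (M (Suc (Suc (k + p))) i)"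
          "Y (Suc p) j = - (\<epsilon> * alt i * u (M (Suc (Suc (k + p))) (i - 1)))"
          "Y p j = \<epsilon> * alt i * u (M (Suc (k + p)) i)"
          using alt_diff_1[of i] by (simp_all add: Y_def i_def algebra_simps)
        have "(if p = 0 then 0 else \<beta> p j * Y (p - 1) j - \<alpha> p j * Y (p - 1) (j - 1)) =
            - (t (k + p) (i + 1) * (\<epsilon> * alt i * u (M (k + p) (i + 1)))
               + s (k + p) i * (\<epsilon> * alt i * u (M (k + p) i)))"
        proof (cases p)
          case 0
          have "u (M k i) = 0" "u (M k (i + 1)) = 0"
            using i1[of i k] i1[of "i + 1" k] that l(1) 0 by (auto simp: i2_def i_def)
          then show ?thesis using 0 by simp
        next
          case (Suc p')
          then have "Y (p - 1) j = - (\<epsilon> * alt i * u (M (k + p) (i + 1)))"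
            "Y (p - 1) (j - 1) = \<epsilon> * alt i * u (M (k + p) i)"
            using alt_add_1(1)[of i] by (simp_all add: Y_def i_def algebra_simps)
          then show ?thesis using Suc unfolding coeffs by simp
        qed
        then show ?thesis
          unfolding coeffs Y using main by linarith
      qed
      show "\<And>l. H l > 0" by (rule H)
      show "\<alpha> q (l + 1) * H (l + 1) = \<beta> q l * H l" for l
        using \<alpha>\<beta>_pos(1)[of q "l + 1"] H(2)[of l] by (simp add: field_simps)
    qed
    from this[unfolded dominates_def, rule_format, of 1]
    obtain l1 where l1: "\<And>l. l \<ge> l1 \<Longrightarrow> Y q l \<ge> 1 * H l" by blast
    \<comment> \<open>The shear puts index \<open>i\<close> of column \<open>m\<close> at
      \<open>i + q\<close>, so \<open>j - q\<close> must be at least \<open>i0\<close> for the right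
      boundary values to vanish.\<close>
    define j where "j = max l1 (i0 + int q)"
    have "Y q j > 0" using l1[of j] H(1)[of j] by (simp add: j_def)
    moreover have "u (M (Suc k + q) (j - int q)) = 0"
      using right[of "j - int q"] km by (simp add: q_def j_def)
    ultimately show ?thesis by (simp add: Y_def)
  qed
qed

end

lemma lap_linear:
  "lap m W (\<lambda>x. a * f x + b * g x) x = a * lap m W f x + b * lap m W g x"
  by (cases x) (simp add: lap_def algebra_simps)

lemma lap_cong:
  assumes "\<And>j i'. j \<le> m \<Longrightarrow> i' \<in> {i - 1..i + 1} \<Longrightarrow> f (M j i') = g (M j i')" and "k \<le> m"
  shows "lap m W f (M k i) = lap m W g (M k i)"
  using assms by (auto simp: lap_def)

section \<open>Vanishing towards - infinity and finite support\<close>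

context strip
begin

text \<open>\<open>alt i * H i\<close> spans the solutions of the equation that remains at column
  \<open>k\<close> when the columns up to \<open>k\<close> are zero; one period multiplies it by
  \<open>layer_radius k\<close> up to the sign of \<open>alt (int n)\<close>.\<close>

lemma straight_mode:
  assumes "k < m"
  obtains H where "\<And>i. H i > 0" "\<And>i. s k (i + 1) * H (i + 1) = t k (i + 1) * H i"
    "\<And>i. H (i + int n) = layer_radius k * H i"
proof -
  obtain H where H: "\<And>i. H i > 0" "\<And>i. H (i + 1) = (t k (i + 1) / s k (i + 1)) * H i"
    using int_recursion_exists[of "\<lambda>i. t k (i + 1) / s k (i + 1)"]
      slanted_pos[OF assms] straight_pos[OF assms] by (metis divide_pos_pos)
  have "H (i + int n) = (\<Prod>j\<in>{0..<0 + int n}. t k (j + 1) / s k (j + 1)) * H i" for i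
    by (rule multiplier_period[where g = "\<lambda>j. t k (j + 1) / s k (j + 1)" and H = H, OF _ H(1) H(2)])
      (use straight_periodic[of k "_ + 1"] slanted_periodic[of k "_ + 1"] in \<open>simp add: algebra_simps\<close>)
  moreover have "s k (i + 1) * H (i + 1) = t k (i + 1) * H i" for i
    using H(2)[of i] straight_pos[OF assms, of "i + 1"] by (simp add: field_simps)
  ultimately show ?thesis
    using that[of H] H(1) unfolding layer_radius_shift(1)[of k 1 1, symmetric] by simp
qed

text \<open>
  Downwards the order of the radii is the wrong one for a growth argument.  Instead, the shift by \<open>n\<close>
  acts on the solutions near \<open>- \<infinity>\<close> with zero data, and it is annihilated by a product of factors
  \<open>1 - z * shift\<close>, one for each column; an eigenfunction extends to the whole strip by quasi-periodicity,
  where it vanishes upwards.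
\<close>

lemma eigenfunction_vanishes:
  assumes sorted: sorted_radii and u: "harmonic m W u"
    and left: "\<And>i. i \<le> i0 \<Longrightarrow> u (M 0 i) = 0" "\<And>i. i \<le> i0 \<Longrightarrow> lap m W u (M 0 i) = 0"
    and right: "\<And>i. i \<le> i0 \<Longrightarrow> u (M m i) = 0"
    and eigen: "\<And>i j. i \<le> i0 \<Longrightarrow> j \<le> m \<Longrightarrow> u (M j i) = z * u (M j (i - int n))"
    and z: "z \<noteq> 0" and "i \<le> i0" "j \<le> m"
  shows "u (M j i) = 0"
proof -
  \<comment> \<open>\<open>r0 i\<close> periods suffice to move \<open>i\<close> down to
    \<open>i0\<close> or below since \<open>n \<ge> 1\<close>. It is 0 for
    \<open>i \<le> i0\<close>, so the quasi-periodic extension \<open>v\<close> agrees with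
    \<open>u\<close> there.\<close>
  define r0 where "r0 i = nat (i - i0)" for i
  define v where "v x = (case x of M j i \<Rightarrow> z ^ r0 i * u (M j (i - int n * int (r0 i))))" for x
  have r0: "i - int n * int r \<le> i0" if "r \<ge> r0 i" for r i
  proof -
    have "i - i0 \<le> int r" using that by (simp add: r0_def)
    also have "\<dots> \<le> int n * int r" using mult_right_mono[of 1 "int n" "int r"] n_pos by simp
    finally show ?thesis by simp
  qed
  have v: "v (M j i) = z ^ r * u (M j (i - int n * int r))" if "r \<ge> r0 i" "j \<le> m" for r i j
    using that(1)
  proof (induction rule: dec_induct)
    case (step r)
    then show ?case
      using eigen[OF r0[of i r] that(2)] by (simp add: algebra_simps)
  qed (simp add: v_def)
  have lap_v: "\<exists>r. lap m W v (M j i) = z ^ r * lap m W u (M j (i - int n * int r)) \<and> i - int n * int r \<le> i0"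
    if "j \<le> m" for j i
  proof -
    \<comment> \<open>By the eigenvalue equation every sufficiently large number of periods gives
      the same \<open>v\<close>. One number is needed that serves all three indices seen by the
      Laplacian at \<open>i\<close>, and \<open>i + 1\<close> requires the most.\<close>
    define r where "r = r0 (i + 1)"
    have r: "r \<ge> r0 i'" if "i' \<in> {i - 1..i + 1}" for i'
      using that by (simp add: r_def r0_def nat_mono)
    have "lap m W v (M j i) =
        lap m W (\<lambda>x. z ^ r * (case x of M j i \<Rightarrow> u (M j (i + int n * - int r))) + 0 * 0) (M j i)"
      by (rule lap_cong) (use v r that in auto)
    also have "\<dots> = z ^ r * lap m W u (M j (i - int n * int r))"
      using lap_shift[of u "- int r" j i]
      unfolding lap_linear by simp
    finally show ?thesis using r0[of i r] r[of i] by auto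
  qed
  have "harmonic m W v"
    unfolding harmonic_def cover_interior_def
  proof clarify
    fix k i assume k: "0 < k" "k < m"
    obtain r where "lap m W v (M k i) = z ^ r * lap m W u (M k (i - int n * int r))"
      using lap_v[of k i] k by auto
    then show "lap m W v (M k i) = 0" using harmonicD[OF u k] by simp
  qed
  moreover have "lap m W v (M 0 i) = 0" for i
    using lap_v[of 0 i] left(2) by auto
  moreover have "v (M 0 i) = 0" "v (M m i) = 0" for i
    using left(1) right r0[of i "r0 i"] by (auto simp: v_def)
  ultimately have "\<exists>i1. \<forall>i\<ge>i1. \<forall>j\<le>m. v (M j i) = 0"
    using vanishes_upwards[OF sorted, of v 0 m] by simp
  then obtain i1 where i1: "\<And>i j. i \<ge> i1 \<Longrightarrow> j \<le> m \<Longrightarrow> v (M j i) = 0" by blast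
  \<comment> \<open>Move up by \<open>a\<close> periods into the region where \<open>v\<close>
    vanishes and return with the power of \<open>z\<close>, which is nonzero.\<close>
  define a where "a = nat (i1 - i)"
  have "i1 - i \<le> int a" by (simp add: a_def)
  also have "\<dots> \<le> int n * int a" using mult_right_mono[of 1 "int n" "int a"] n_pos by simp
  finally have "v (M j (i + int n * int a)) = 0" using i1 \<open>j \<le> m\<close> by simp
  moreover have "v (M j (i + int n * int a)) =
      z ^ (a + r0 (i + int n * int a)) * u (M j (i + int n * int a - int n * int (a + r0 (i + int n * int a))))"
    by (rule v) (use \<open>j \<le> m\<close> in auto)
  moreover have "v (M j i) = z ^ r0 (i + int n * int a) * u (M j (i - int n * int (r0 (i + int n * int a))))"
    by (rule v) (use \<open>j \<le> m\<close> in \<open>auto simp: r0_def intro!: nat_mono\<close>)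
  moreover have "v (M j i) = u (M j i)"
    using \<open>i \<le> i0\<close> by (simp add: v_def r0_def)
  ultimately show ?thesis using z by (simp add: algebra_simps)
qed

lemma vanishes_downwards_from:
  assumes sorted: sorted_radii and "1 \<le> k" "k \<le> m"
    and "harmonic m W u"
    and "\<And>i. i \<le> i0 \<Longrightarrow> lap m W u (M 0 i) = 0"
    and "\<And>i. i \<le> i0 \<Longrightarrow> u (M m i) = 0"
    and "\<And>i j. i \<le> i0 \<Longrightarrow> j < k \<Longrightarrow> u (M j i) = 0"
  shows "\<exists>i1. \<forall>i\<le>i1. \<forall>j\<le>m. u (M j i) = 0"
  using assms(3,2,4-)
proof (induction k arbitrary: u i0 rule: inc_induct)
  case base
  then show ?case by (intro exI[of _ i0]) (auto simp: le_less)
next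
  case (step k)
  note u = \<open>harmonic m W u\<close>
  have k: "1 \<le> k" "k < m" "k - 1 < m" using step.hyps step.prems by auto
  \<comment> \<open>The equation at column \<open>k - 1\<close> involves index \<open>i + 1\<close>
    of the column to its left, which costs one index: \<open>i < i0\<close> rather than
    \<open>i \<le> i0\<close>.\<close>
  have kernel: "s (k - 1) i * u (M k i) + t (k - 1) i * u (M k (i - 1)) = 0" if "i < i0" for i
  proof -
    have "u (M (k - 1) i) = 0" "u (M (k - 1 - 1) i) = 0" "u (M (k - 1 - 1) (i + 1)) = 0"
      using step.prems(5) k(1) that by auto
    moreover have "lap m W u (M (k - 1) i) = 0"
      using step.prems(3)[of i] harmonicD[OF u, of "k - 1" i] that k by (cases "k - 1 = 0") auto
    ultimately show ?thesis
      using k by (auto simp: lap_def split: if_splits)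
  qed
  obtain H where H: "\<And>i. H i > 0" "\<And>i. s (k - 1) (i + 1) * H (i + 1) = t (k - 1) (i + 1) * H i"
    "\<And>i. H (i + int n) = layer_radius (k - 1) * H i"
    using straight_mode[OF k(3)] by metis
  define \<kappa> where "\<kappa> i = alt i * u (M k i) / H i" for i
  have "\<kappa> (i + 1) = \<kappa> i" if "i < i0 - 1" for i
  proof -
    have p: "H i > 0" "H (i + 1) > 0" "s (k - 1) (i + 1) > 0" "t (k - 1) (i + 1) > 0"
      using H(1) straight_pos[OF k(3)] slanted_pos[OF k(3)] by auto
    have "s (k - 1) (i + 1) * u (M k (i + 1)) = - t (k - 1) (i + 1) * u (M k i)"
      using kernel[of "i + 1"] that by simp
    then have "(s (k - 1) (i + 1) * u (M k (i + 1))) * (t (k - 1) (i + 1) * H i) =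
        (- t (k - 1) (i + 1) * u (M k i)) * (s (k - 1) (i + 1) * H (i + 1))"
      using H(2)[of i] by simp
    then have "(s (k - 1) (i + 1) * t (k - 1) (i + 1)) * (u (M k (i + 1)) * H i + u (M k i) * H (i + 1)) = 0"
      by (simp add: algebra_simps)
    then have "u (M k (i + 1)) * H i = - u (M k i) * H (i + 1)"
      using p unfolding mult_eq_0_iff by linarith
    then have "u (M k (i + 1)) / H (i + 1) = - (u (M k i) / H i)"
      using p by (simp add: field_simps)
    moreover have "\<kappa> (i + 1) = - alt i * (u (M k (i + 1)) / H (i + 1))" by (simp add: \<kappa>_def)
    ultimately show ?thesis by (simp add: \<kappa>_def)
  qed
  then have \<kappa>: "\<kappa> i = \<kappa> (i0 - 1)" if "i \<le> i0 - 1" for i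
    using int_shift_invariant_le[of "i0 - 1" \<kappa> i] that by blast
  have u_k: "u (M k i) = \<kappa> (i0 - 1) * alt i * H i" if "i \<le> i0 - 1" for i
  proof -
    have "alt i * u (M k i) = \<kappa> (i0 - 1) * H i"
      using H(1)[of i] unfolding \<kappa>[OF that, symmetric] by (simp add: \<kappa>_def)
    then have "alt i * (alt i * u (M k i)) = alt i * (\<kappa> (i0 - 1) * H i)" by simp
    then show ?thesis by (simp add: mult_ac)
  qed
  \<comment> \<open>The factor by which the alternating mode changes over one period;
    \<open>alt (int n)\<close> is its sign.\<close>
  define z where "z = alt (int n) * layer_radius (k - 1)"
  have z: "z \<noteq> 0" using layer_radius_pos[OF k(3)] by (simp add: z_def)
  have alt_diff: "alt (i - int n) = alt i * alt (int n)" for i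
    by (auto simp: alt_def)
  have eigen_k: "u (M k i) = z * u (M k (i - int n))" if "i \<le> i0 - 1" for i
    using that H(3)[of "i - int n"] u_k[of i] u_k[of "i - int n"]
    by (simp add: z_def alt_diff)
  \<comment> \<open>Subtracting \<open>z\<close> times the shift kills column \<open>k\<close> as
    well, so the induction hypothesis applies to \<open>v\<close>. Where \<open>v\<close> vanishes
    in all columns, \<open>u\<close> itself is an eigenfunction of the shift.\<close>
  define v where "v x = 1 * u x + - z * (case x of M j i \<Rightarrow> u (M j (i + int n * - 1)))" for x
  have lap_v: "lap m W v (M j i) = lap m W u (M j i) - z * lap m W u (M j (i - int n))" for j i
    unfolding v_def lap_linear lap_shift by simp
  have "\<exists>i1. \<forall>i\<le>i1. \<forall>j\<le>m. v (M j i) = 0"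
  proof (rule step.IH[of v "i0 - 1"])
    show "harmonic m W v"
      using harmonicD[OF u] by (auto simp: harmonic_def cover_interior_def lap_v)
    show "v (M j i) = 0" if "i \<le> i0 - 1" "j < Suc k" for i j
      using that eigen_k[of i] step.prems(5)[of i j] step.prems(5)[of "i - int n" j] n_pos
      by (auto simp: v_def less_Suc_eq)
    show "lap m W v (M 0 i) = 0" if "i \<le> i0 - 1" for i
      using that step.prems(3) n_pos by (simp add: lap_v)
    show "v (M m i) = 0" if "i \<le> i0 - 1" for i
      using that step.prems(4) n_pos by (simp add: v_def)
  qed simp
  then obtain i1 where i1: "\<And>i j. i \<le> i1 \<Longrightarrow> j \<le> m \<Longrightarrow> v (M j i) = 0" by auto
  have "u (M j i) = 0" if "i \<le> min i0 i1" "j \<le> m" for i j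
  proof (rule eigenfunction_vanishes[OF sorted u, of "min i0 i1" z])
    show "u (M j i) = z * u (M j (i - int n))" if "i \<le> min i0 i1" "j \<le> m" for i j
      using i1[of i j] that by (simp add: v_def)
  qed (use step.prems k z that in auto)
  then show ?case by blast
qed

text \<open>This is how a function built from Poisson kernels, whose supports are in general
  infinite, is recognised as finitely supported.\<close>

lemma finite_support_of_finite_cauchy_data:
  assumes sorted: sorted_radii and u: "harmonic m W u"
    and left: "finite {i. u (M 0 i) \<noteq> 0}" "finite {i. lap m W u (M 0 i) \<noteq> 0}"
    and right: "finite {i. u (M m i) \<noteq> 0}"
  shows "finite {x \<in> cover_vertices m. u x \<noteq> 0}"
proof -
  define A where "A = {i. u (M 0 i) \<noteq> 0} \<union> {i. lap m W u (M 0 i) \<noteq> 0} \<union> {i. u (M m i) \<noteq> 0}"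
  have A: "finite A" using assms by (simp add: A_def)
  define b where "b = Max (abs ` insert 0 A)"
  have b: "i \<notin> A" if "\<bar>i\<bar> > b" for i
  proof
    assume "i \<in> A"
    then have "\<bar>i\<bar> \<le> b" unfolding b_def using A by (intro Max_ge) auto
    with that show False by simp
  qed
  then have out: "u (M 0 i) = 0" "lap m W u (M 0 i) = 0" "u (M m i) = 0" if "\<bar>i\<bar> > b" for i
    using that by (auto simp: A_def)
  have "b \<ge> 0" unfolding b_def using A by (intro Max_ge) auto
  then have "\<exists>i1. \<forall>i\<ge>i1. \<forall>j\<le>m. u (M j i) = 0"
    using vanishes_upwards[OF sorted u, of "b + 1" m] out by simp
  then obtain i1 where i1: "\<And>i j. i \<ge> i1 \<Longrightarrow> j \<le> m \<Longrightarrow> u (M j i) = 0" by blast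
  have "\<exists>i1. \<forall>i\<le>i1. \<forall>j\<le>m. u (M j i) = 0"
    using vanishes_downwards_from[OF sorted _ m_pos u, of "- b - 1"] out \<open>b \<ge> 0\<close> by simp
  then obtain i2 where i2: "\<And>i j. i \<le> i2 \<Longrightarrow> j \<le> m \<Longrightarrow> u (M j i) = 0" by blast
  have "{x \<in> cover_vertices m. u x \<noteq> 0} \<subseteq> (\<lambda>(j, i). M j i) ` ({..m} \<times> {i2..i1})"
  proof clarify
    fix x assume x: "x \<in> cover_vertices m" "u x \<noteq> 0"
    then obtain j i where ji: "x = M j i" "j \<le> m" by (auto simp: cover_vertices_def)
    have "\<not> i \<ge> i1" "\<not> i \<le> i2" using i1 i2 x(2) ji by auto
    with ji show "x \<in> (\<lambda>(j, i). M j i) ` ({..m} \<times> {i2..i1})" by force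
  qed
  then show ?thesis by (rule finite_subset) auto
qed

text \<open>Consider the last nonzero column \<open>k\<close>. If it is the left boundary, the first
  alternative holds. Otherwise it is a pure alternating mode by the equation at column
  \<open>k + 1\<close>, and the growth argument, run from right to left, makes column 0 dominate the
  mode of the first layer.\<close>

lemma right_zero_dichotomy:
  assumes sorted: sorted_radii and u: "harmonic m W u"
    and right: "\<And>i. u (M m i) = 0" "\<And>i. lap m W u (M m i) = 0"
    and nonzero: "u (M 0 a) \<noteq> 0"
    and H: "\<And>i. H i > 0" "\<And>i. t 0 (i + 1) * H (i + 1) = s 0 i * H i"
  shows "(\<forall>j i. 1 \<le> j \<longrightarrow> j \<le> m \<longrightarrow> u (M j i) = 0) \<or> dominates (\<lambda>i. \<bar>u (M 0 i)\<bar>) H"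
proof -
  define k where "k = (GREATEST k. k \<le> m \<and> (\<exists>i. u (M k i) \<noteq> 0))"
  have k: "k \<le> m \<and> (\<exists>i. u (M k i) \<noteq> 0)"
    unfolding k_def by (rule GreatestI_nat[of _ 0 m]) (use nonzero in auto)
  have above: "u (M j i) = 0" if "k < j" "j \<le> m" for j i
    using Greatest_le_nat[of "\<lambda>k. k \<le> m \<and> (\<exists>i. u (M k i) \<noteq> 0)" j m] that
    by (auto simp: k_def[symmetric])
  have km: "k < m" using k right(1) by (cases "k = m") auto
  obtain l where l: "u (M k l) \<noteq> 0" using k by auto
  show ?thesis
  proof (cases "k = 0")
    case True
    then show ?thesis using above by auto
  next
    case False
    have lap0: "lap m W u (M j i) = 0" if "0 < j" "j \<le> m" for i j
      using that right(2) harmonicD[OF u, of j i] by (cases "j = m") auto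
    have kernel: "s k i * u (M k i) + t k (i + 1) * u (M k (i + 1)) = 0" for i
    proof -
      have "u (M (Suc k) i) = 0" "Suc k < m \<Longrightarrow> u (M (Suc (Suc k)) i) = 0"
        "Suc k < m \<Longrightarrow> u (M (Suc (Suc k)) (i - 1)) = 0"
        using above km by auto
      with lap0[of "Suc k" i] km show ?thesis
        by (auto simp: lap_def split: if_splits)
    qed
    define \<alpha> \<beta> where "\<alpha> p j = t (k - p) j" and "\<beta> p j = s (k - p) j" for p j
    define \<epsilon> where "\<epsilon> = sgn (alt l * u (M k l))"
    define Y where "Y p j = \<epsilon> * alt (j + int p) * u (M (k - p) j)" for p j
    have "dominates (Y k) H"
    proof (rule alternating_growth_mode[where \<alpha> = \<alpha> and \<beta> = \<beta> and n = n and lb = l])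
      show "n \<ge> 1" by (rule n_pos)
      show "k \<ge> 1" using False by simp
      show "\<alpha> p j > 0 \<and> \<beta> p j > 0" for p j
        using straight_pos[of "k - p"] slanted_pos[of "k - p"] km by (auto simp: \<alpha>_def \<beta>_def)
      show "\<alpha> p (j + int n) = \<alpha> p j \<and> \<beta> p (j + int n) = \<beta> p j" for p j
        using straight_periodic slanted_periodic by (simp add: \<alpha>_def \<beta>_def)
      have "(\<Prod>j\<in>{0..<int n}. \<beta> p j / \<alpha> p (j + 1)) = inverse (layer_radius (k - p))" for p
        using layer_radius_shift(2)[of "k - p" 0 1] by (simp add: \<alpha>_def \<beta>_def)
      \<comment> \<open>Two reversals cancel: layers are now read from right to left, and
        multipliers are inverse radii, so they decrease again.\<close>
      moreover have "inverse (layer_radius (k - Suc p)) \<le> inverse (layer_radius (k - p))" if "p < k" for p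
      proof (rule le_imp_inverse_le)
        have "Suc (k - Suc p) = k - p" using that by simp
        then show "layer_radius (k - p) \<le> layer_radius (k - Suc p)"
          using sorted km unfolding sorted_radii_def by (metis less_imp_diff_less)
        show "layer_radius (k - p) > 0" using layer_radius_pos km by simp
      qed
      ultimately show "(\<Prod>j\<in>{0..<int n}. \<beta> (Suc p) j / \<alpha> (Suc p) (j + 1))
          \<le> (\<Prod>j\<in>{0..<int n}. \<beta> p j / \<alpha> p (j + 1))" if "p < k" for p
        using that by simp
      have "Y 0 l = \<bar>alt l * u (M k l)\<bar>"
        by (simp add: Y_def \<epsilon>_def abs_sgn mult_ac)
      then show "Y 0 l > 0" using l by simp
      show "\<alpha> 0 (j + 1) * Y 0 (j + 1) = \<beta> 0 j * Y 0 j" for j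
      proof -
        have "\<epsilon> * alt j * (s k j * u (M k j) + t k (j + 1) * u (M k (j + 1))) = 0"
          using kernel[of j] by simp
        then show ?thesis by (simp add: \<alpha>_def \<beta>_def Y_def algebra_simps)
      qed
      show "\<alpha> (Suc p) (j + 1) * Y (Suc p) (j + 1) - \<beta> (Suc p) j * Y (Suc p) j =
        (\<alpha> (Suc p) (j + 1) + \<beta> (Suc p) j + \<alpha> p j + \<beta> p j) * Y p j
        + (if p = 0 then 0 else \<beta> p j * Y (p - 1) j - \<alpha> p j * Y (p - 1) (j - 1))"
        if "p < k" for p j
      proof -
        define c where "c = k - Suc p"
        have c: "k - p = Suc c" "Suc c < m" using that km by (auto simp: c_def)
        define A where "A = \<epsilon> * alt (j + int p)"
        have "A * lap m W u (M (Suc c) j) = 0"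
          using harmonicD[OF u _ c(2)] by simp
        then have main: "s (Suc c) j * (A * u (M (Suc (Suc c)) j))
            + t (Suc c) j * (A * u (M (Suc (Suc c)) (j - 1)))
            + s c j * (A * u (M c j)) + t c (j + 1) * (A * u (M c (j + 1)))
            = (s (Suc c) j + t (Suc c) j + s c j + t c (j + 1)) * (A * u (M (Suc c) j))"
          unfolding lap_Suc[OF c(2)] by (simp add: algebra_simps)
        have coeffs: "\<alpha> (Suc p) (j + 1) = t c (j + 1)" "\<beta> (Suc p) j = s c j"
          "\<alpha> p j = t (Suc c) j" "\<beta> p j = s (Suc c) j"
          using c by (simp_all add: \<alpha>_def \<beta>_def c_def)
        have alts: "alt (j + 1 + int (Suc p)) = alt (j + int p)" "alt (j + int (Suc p)) = - alt (j + int p)"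
          by (simp_all add: alt_def)
        have Y: "Y (Suc p) (j + 1) = A * u (M c (j + 1))"
          "Y (Suc p) j = - (A * u (M c j))"
          "Y p j = A * u (M (Suc c) j)"
          unfolding Y_def alts using c by (simp_all add: A_def c_def)
        have extra: "(if p = 0 then 0 else \<beta> p j * Y (p - 1) j - \<alpha> p j * Y (p - 1) (j - 1)) =
            - (s (Suc c) j * (A * u (M (Suc (Suc c)) j))
               + t (Suc c) j * (A * u (M (Suc (Suc c)) (j - 1))))"
        proof (cases p)
          case 0
          have "u (M (Suc (Suc c)) j) = 0" "u (M (Suc (Suc c)) (j - 1)) = 0"
            using above c 0 by auto
          then show ?thesis using 0 by simp
        next
          case (Suc p')
          have "k - p' = Suc (Suc c)" using that Suc by (simp add: c_def)
          then have "Y (p - 1) j = - (A * u (M (Suc (Suc c)) j))"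
            "Y (p - 1) (j - 1) = A * u (M (Suc (Suc c)) (j - 1))"
            using Suc by (simp_all add: Y_def A_def alt_def)
          then show ?thesis using Suc unfolding coeffs by simp
        qed
        show ?thesis
          unfolding extra unfolding coeffs Y using main by (simp add: algebra_simps)
      qed
      show "\<And>l. H l > 0" by (rule H)
      show "\<alpha> k (l + 1) * H (l + 1) = \<beta> k l * H l" for l
        using H(2) by (simp add: \<alpha>_def \<beta>_def)
    qed
    moreover have "Y k i \<le> \<bar>u (M 0 i)\<bar>" for i
    proof -
      have "\<bar>Y k i\<bar> \<le> \<bar>u (M 0 i)\<bar>"
        by (simp add: Y_def \<epsilon>_def abs_mult sgn_if)
      then show ?thesis by simp
    qed
    ultimately show ?thesis
      unfolding dominates_def by (meson order_trans)
  qed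
qed

end

section \<open>Kirchhoff matrices and Green's identity\<close>

text \<open>Take \<open>\<phi> = \<rho> \<circ> g\<close> for a linear right inverse
  \<open>g\<close> of \<open>T\<close> on the image of \<open>V\<close>; two preimages in
  \<open>V\<close> differ by a kernel element, where \<open>\<rho>\<close> vanishes. No finite
  dimension is involved, so this serves both for inverting a finite matrix and for solving an
  infinite system with finite rows.\<close>

lemma linear_functional_factors:
  fixes T :: "('a \<Rightarrow> real) \<Rightarrow> 'b \<Rightarrow> real" and \<rho> :: "('a \<Rightarrow> real) \<Rightarrow> real"
  assumes T: "\<And>c d f g y. T (\<lambda>x. c * f x + d * g x) y = c * T f y + d * T g y"
    and V0: "(\<lambda>_. 0) \<in> V"
    and V: "\<And>c d f g. f \<in> V \<Longrightarrow> g \<in> V \<Longrightarrow> (\<lambda>x. c * f x + d * g x) \<in> V"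
    and \<rho>: "\<And>c d f g. f \<in> V \<Longrightarrow> g \<in> V \<Longrightarrow> \<rho> (\<lambda>x. c * f x + d * g x) = c * \<rho> f + d * \<rho> g"
    and ker: "\<And>f. f \<in> V \<Longrightarrow> (\<And>y. T f y = 0) \<Longrightarrow> \<rho> f = 0"
  obtains \<phi> where "\<And>c d f g. \<phi> (\<lambda>x. c * f x + d * g x) = c * \<phi> f + d * \<phi> g"
    and "\<And>f. f \<in> V \<Longrightarrow> \<phi> (T f) = \<rho> f"
proof -
  let ?sa = "\<lambda>c (f :: 'a \<Rightarrow> real) x. c * f x" and ?sb = "\<lambda>c (f :: 'b \<Rightarrow> real) x. c * f x"
  interpret vector_space_pair ?sa ?sb
    by unfold_locales (auto simp: algebra_simps fun_eq_iff)
  have T_add: "T (f + g) = T f + T g" for f g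
    using T[of 1 f 1 g] by (simp add: plus_fun_def fun_eq_iff)
  have T_scale: "T (?sa c f) = ?sb c (T f)" for c f
    using T[of c f 0 f] by (simp add: fun_eq_iff)
  have "Vector_Spaces.linear ?sa ?sb T"
    by unfold_locales (use T_add T_scale in auto)
  moreover have "vs1.subspace V"
    unfolding vs1.subspace_def
    using V0 V[of _ _ 1 1] V[of _ "\<lambda>_. 0" _ 0] by (auto simp: zero_fun_def plus_fun_def)
  ultimately obtain g where g: "range g \<subseteq> V" "Vector_Spaces.linear ?sb ?sa g" "\<And>v. v \<in> V \<Longrightarrow> T (g (T v)) = T v"
    using linear_exists_right_inverse_on[of T V] by auto
  interpret g: Vector_Spaces.linear ?sb ?sa g by (rule g(2))
  have g_lin: "g (\<lambda>x. c * f x + d * h x) = (\<lambda>x. c * g f x + d * g h x)" for c d f h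
    using g.add[of "?sb c f" "?sb d h"] g.scale[of c f] g.scale[of d h] by (simp add: plus_fun_def)
  have "\<rho> (g (T f)) = \<rho> f" if f: "f \<in> V" for f
  proof -
    have gV: "g (T f) \<in> V" using g(1) by auto
    have "\<rho> (\<lambda>x. 1 * g (T f) x + (- 1) * f x) = 0"
    proof (rule ker)
      show "(\<lambda>x. 1 * g (T f) x + (- 1) * f x) \<in> V" by (rule V[OF gV f])
      show "T (\<lambda>x. 1 * g (T f) x + (- 1) * f x) y = 0" for y
        unfolding T by (simp add: g(3)[OF f])
    qed
    then show ?thesis unfolding \<rho>[OF gV f] by simp
  qed
  moreover have "\<rho> (g (\<lambda>x. c * f x + d * h x)) = c * \<rho> (g f) + d * \<rho> (g h)" for c d f h
    unfolding g_lin by (rule \<rho>) (use g(1) in auto)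
  ultimately show ?thesis using that[of "\<lambda>f. \<rho> (g f)"] by blast
qed

lemma linear_functional_sum:
  fixes \<phi> :: "('a \<Rightarrow> real) \<Rightarrow> real"
  assumes "\<And>c d f g. \<phi> (\<lambda>x. c * f x + d * g x) = c * \<phi> f + d * \<phi> g" and "finite A"
  shows "\<phi> (\<lambda>x. \<Sum>a\<in>A. c a * f a x) = (\<Sum>a\<in>A. c a * \<phi> (f a))"
  using assms(2)
proof (induction A rule: finite_induct)
  case empty
  then show ?case using assms(1)[of 0 undefined 0 undefined] by simp
next
  case (insert a A)
  then show ?case
    using assms(1)[of "c a" "f a" 1 "\<lambda>x. \<Sum>a\<in>A. c a * f a x"] by simp
qed

text \<open>Injectivity provides for each \<open>u\<close> a functional recovering
  \<open>f u\<close> from the image of \<open>f\<close>; these functionals form a left inverse. By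
  symmetry of \<open>A\<close> its transpose is a right inverse, so the two coincide and the
  description in \<open>inverse_on\<close> has exactly one solution.\<close>

lemma inverse_on_symmetric:
  fixes A :: "'v \<Rightarrow> 'v \<Rightarrow> real"
  assumes I: "finite I" and sym: "\<And>u v. u \<in> I \<Longrightarrow> v \<in> I \<Longrightarrow> A u v = A v u"
    and inj: "\<And>g. (\<And>u. u \<in> I \<Longrightarrow> (\<Sum>x\<in>I. A u x * g x) = 0) \<Longrightarrow> \<forall>u\<in>I. g u = 0"
    and "u \<in> I" "v \<in> I"
  shows "(\<Sum>x\<in>I. A u x * inverse_on I A x v) = (if u = v then 1 else 0)"
proof -
  define T where "T f u = (if u \<in> I then \<Sum>x\<in>I. A u x * f x else 0)" for f u
  define V where "V = {f :: 'v \<Rightarrow> real. \<forall>u. u \<notin> I \<longrightarrow> f u = 0}"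
  have "\<exists>\<phi>. (\<forall>c d f g. \<phi> (\<lambda>x. c * f x + d * g x) = c * \<phi> f + d * \<phi> g) \<and> (\<forall>f\<in>V. \<phi> (T f) = f u)"
    if "u \<in> I" for u
  proof (rule linear_functional_factors[of T V "\<lambda>f. f u"])
    show "T (\<lambda>x. c * f x + d * g x) y = c * T f y + d * T g y" for c d f g y
      by (simp add: T_def sum_distrib_left sum.distrib algebra_simps)
    show "f u = 0" if "f \<in> V" "\<And>y. T f y = 0" for f
      using inj[of f] that(2) \<open>u \<in> I\<close> unfolding T_def by (metis (full_types))
  qed (auto simp: V_def)
  then obtain \<phi> where \<phi>: "\<And>u c d f g. u \<in> I \<Longrightarrow> \<phi> u (\<lambda>x. c * f x + d * g x) = c * \<phi> u f + d * \<phi> u g"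
    "\<And>u f. u \<in> I \<Longrightarrow> f \<in> V \<Longrightarrow> \<phi> u (T f) = f u"
    by metis
  define \<delta> where "\<delta> v x = (if x = v then 1 else 0 :: real)" for v x :: 'v
  define B where "B u v = (if u \<in> I \<and> v \<in> I then \<phi> u (\<delta> v) else 0)" for u v
  have BA: "(\<Sum>x\<in>I. B u x * A x v) = \<delta> v u" if "u \<in> I" "v \<in> I" for u v
  proof -
    have "T (\<delta> v) = (\<lambda>y. \<Sum>x\<in>I. A x v * \<delta> x y)"
      using I that by (auto simp: T_def \<delta>_def fun_eq_iff if_distrib cong: if_cong)
    then have "\<phi> u (T (\<delta> v)) = (\<Sum>x\<in>I. A x v * \<phi> u (\<delta> x))"
      using linear_functional_sum[of "\<phi> u" I "\<lambda>x. A x v" \<delta>] \<phi>(1)[OF that(1)] I by simp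
    then show ?thesis
      using \<phi>(2)[OF that(1), of "\<delta> v"] that by (simp add: V_def \<delta>_def B_def mult.commute)
  qed
  have AB': "(\<Sum>x\<in>I. A u x * B v x) = \<delta> v u" if "u \<in> I" "v \<in> I" for u v
    using BA[OF that(2,1)] sym that by (simp add: \<delta>_def mult.commute cong: sum.cong)
  have B_sym: "B u v = B v u" if uv: "u \<in> I" "v \<in> I" for u v
  proof -
    have "B u v = (\<Sum>x\<in>I. B u x * (\<Sum>y\<in>I. A x y * B v y))"
    proof -
      have "(\<Sum>x\<in>I. B u x * (\<Sum>y\<in>I. A x y * B v y)) = (\<Sum>x\<in>I. if x = v then B u x else 0)"
        by (rule sum.cong) (use AB' uv in \<open>auto simp: \<delta>_def\<close>)
      then show ?thesis using I uv by simp
    qed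
    also have "\<dots> = (\<Sum>y\<in>I. (\<Sum>x\<in>I. B u x * A x y) * B v y)"
      by (simp add: sum_distrib_left sum_distrib_right mult.assoc) (rule sum.swap)
    also have "\<dots> = (\<Sum>y\<in>I. if y = u then B v y else 0)"
      by (rule sum.cong) (use BA uv in \<open>auto simp: \<delta>_def\<close>)
    also have "\<dots> = B v u" using I uv by simp
    finally show ?thesis .
  qed
  have AB: "(\<Sum>x\<in>I. A u x * B x v) = \<delta> v u" if "u \<in> I" "v \<in> I" for u v
    using AB'[OF that] B_sym that by (simp cong: sum.cong)
  let ?P = "\<lambda>B. (\<forall>u v. u \<notin> I \<or> v \<notin> I \<longrightarrow> B u v = 0) \<and>
     (\<forall>u\<in>I. \<forall>v\<in>I. (\<Sum>x\<in>I. A u x * B x v) = (if u = v then 1 else 0)) \<and>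
     (\<forall>u\<in>I. \<forall>v\<in>I. (\<Sum>x\<in>I. B u x * A x v) = (if u = v then 1 else 0))"
  have P: "?P B" using AB BA by (auto simp: B_def \<delta>_def)
  have "C = B" if C: "?P C" for C
  proof (intro ext)
    fix u v
    show "C u v = B u v"
    proof (cases "u \<in> I \<and> v \<in> I")
      case True
      have "C u v = (\<Sum>x\<in>I. C u x * (\<Sum>y\<in>I. A x y * B y v))"
      proof -
        have "(\<Sum>x\<in>I. C u x * (\<Sum>y\<in>I. A x y * B y v)) = (\<Sum>x\<in>I. if x = v then C u x else 0)"
          by (rule sum.cong) (use AB True in \<open>auto simp: \<delta>_def\<close>)
        then show ?thesis using I True by simp
      qed
      also have "\<dots> = (\<Sum>y\<in>I. (\<Sum>x\<in>I. C u x * A x y) * B y v)"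
        by (simp add: sum_distrib_left sum_distrib_right mult.assoc) (rule sum.swap)
      also have "\<dots> = (\<Sum>y\<in>I. if y = u then B y v else 0)"
        by (rule sum.cong) (use C True in auto)
      also have "\<dots> = B u v" using I True by simp
      finally show ?thesis .
    next
      case False
      then show ?thesis using C by (auto simp: B_def)
    qed
  qed
  with P have "inverse_on I A = B"
    unfolding inverse_on_def by (rule the_equality)
  then show ?thesis using AB assms(4,5) by (simp add: \<delta>_def)
qed

section \<open>The Kirchhoff matrix as a local operator, and Green's identity\<close>

definition delta :: "'a \<Rightarrow> 'a \<Rightarrow> real" where
  "delta y x = (if x = y then 1 else 0)"

text \<open>A box containing the vertex and all its neighbours; what matters is that it is finite
  and that the Laplacian looks no further.\<close>

fun nbhd :: "vertex \<Rightarrow> vertex set" where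
  "nbhd (M k i) = {M j i' | j i'. j \<in> {k - 1..k + 1} \<and> i' \<in> {i - 1..i + 1}}"

lemma finite_nbhd [simp]: "finite (nbhd x)"
proof (cases x)
  case (M k i)
  then have "nbhd x = (\<lambda>(j, i'). M j i') ` ({k - 1..k + 1} \<times> {i - 1..i + 1})" by auto
  then show ?thesis by simp
qed

lemma lap_nbhd_cong:
  assumes "\<And>y. y \<in> nbhd x \<Longrightarrow> f y = g y"
  shows "lap m W f x = lap m W g x"
  using assms by (cases x) (auto simp: lap_def)

lemma lap_zero [simp]: "lap m W (\<lambda>_. 0) x = 0"
  by (cases x) (simp add: lap_def)

lemma lap_sum:
  "finite A \<Longrightarrow> lap m W (\<lambda>x. \<Sum>a\<in>A. c a * f a x) x = (\<Sum>a\<in>A. c a * lap m W (f a) x)"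
  by (rule linear_functional_sum[of "\<lambda>f. lap m W f x"]) (rule lap_linear)

abbreviation boundary_vertices :: "nat \<Rightarrow> vertex set" where
  "boundary_vertices m \<equiv> cover_vertices m - cover_interior m"

context strip
begin

abbreviation "K \<equiv> kirchhoff (cover_edges m) ends W"

lemma incident_edges:
  "{e \<in> cover_edges m. M k i \<in> ends e} =
     (if k < m then {Straight k i, Slanted k i} else {}) \<union>
     (if 0 < k \<and> k \<le> m then {Straight (k - 1) i, Slanted (k - 1) (i + 1)} else {})"
  by (auto simp: cover_edges_def)

lemma sum_incident_edges:
  "(\<Sum>e | e \<in> cover_edges m \<and> M k i \<in> ends e. g e) =
     (if k < m then g (Straight k i) + g (Slanted k i) else 0) +
     (if 0 < k \<and> k \<le> m then g (Straight (k - 1) i) + g (Slanted (k - 1) (i + 1)) else 0)"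
proof -
  have "0 < k \<Longrightarrow> k \<noteq> k - 1" by simp
  then show ?thesis
    unfolding incident_edges by (subst sum.union_disjoint) auto
qed

lemma kirchhoff_eq_lap: "K x y = lap m W (delta y) x"
proof (cases x)
  case (M k i)
  show ?thesis
  proof (cases "x = y")
    case True
    then show ?thesis
      using M by (auto simp: kirchhoff_def sum_incident_edges lap_def delta_def)
  next
    case False
    then have "{e \<in> cover_edges m. ends e = {x, y}} =
        {e \<in> {e \<in> cover_edges m. M k i \<in> ends e}. y \<in> ends e}"
      by (auto simp: cover_edges_def M)
    moreover have "finite {e \<in> cover_edges m. M k i \<in> ends e}"
      unfolding incident_edges by simp
    ultimately have K: "K x y = (\<Sum>e | e \<in> cover_edges m \<and> M k i \<in> ends e. if y \<in> ends e then W e else 0)"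
      using False by (simp only: kirchhoff_def if_False sum.inter_filter)
    have e: "(if y \<in> ends (Straight k i) then c else 0) = c * delta y (M (Suc k) i)"
      "(if y \<in> ends (Slanted k i) then c else 0) = c * delta y (M (Suc k) (i - 1))" for c
      using False by (auto simp: M delta_def)
    have e': "(if y \<in> ends (Straight (k - 1) i) then c else 0) = c * delta y (M (k - 1) i)"
      "(if y \<in> ends (Slanted (k - 1) (i + 1)) then c else 0) = c * delta y (M (k - 1) (i + 1))"
      if "0 < k" for c
      using False that by (auto simp: M delta_def)
    have d: "delta y (M k i) = 0" using False by (simp add: M delta_def)
    show ?thesis
    proof (cases "0 < k")
      case True
      show ?thesis
        unfolding K sum_incident_edges e e'[OF True] using d True by (simp add: lap_def M)
    next
      case False
      then have k: "k = 0" by simp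
      show ?thesis
        unfolding K sum_incident_edges e using d by (simp add: lap_def M k)
    qed
  qed
qed

lemma kirchhoff_sym: "K x y = K y x"
  by (simp add: kirchhoff_def insert_commute)

lemma kirchhoff_nbhd: "K x y \<noteq> 0 \<Longrightarrow> y \<in> nbhd x"
proof (rule ccontr)
  assume "K x y \<noteq> 0" "y \<notin> nbhd x"
  then have "lap m W (delta y) x = lap m W (\<lambda>_. 0) x"
    by (intro lap_nbhd_cong) (auto simp: delta_def)
  with \<open>K x y \<noteq> 0\<close> show False by (simp add: kirchhoff_eq_lap)
qed

lemma lap_eq_sum:
  assumes Y: "finite Y" "\<And>y. y \<notin> Y \<Longrightarrow> K x y = 0 \<or> f y = 0"
  shows "lap m W f x = (\<Sum>y\<in>Y. K x y * f y)"
proof -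
  let ?Y = "Y \<union> nbhd x"
  have "(\<Sum>y\<in>Y. K x y * f y) = (\<Sum>y\<in>?Y. f y * K x y)"
  proof (rule sum.mono_neutral_cong_left)
    show "\<forall>y\<in>?Y - Y. f y * K x y = 0" using Y(2) by fastforce
  qed (use Y(1) in auto)
  also have "\<dots> = lap m W (\<lambda>z. \<Sum>y\<in>?Y. f y * delta y z) x"
    using Y(1) by (simp add: lap_sum kirchhoff_eq_lap)
  also have "\<dots> = lap m W f x"
    using Y(1) by (intro lap_nbhd_cong) (simp add: delta_def if_distrib cong: if_cong)
  finally show ?thesis by simp
qed

text \<open>Symmetry of the Kirchhoff matrix, summed over the support of \<open>u\<close> and its
  neighbours. \<open>F\<close> is arbitrary, which is what admits exponentially growing functions.
  The finiteness claim guarantees that the \<open>Sum_any\<close> on the right is a genuine sum and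
  not the default 0.\<close>

lemma green_identity:
  assumes u: "finite {x. u x \<noteq> 0}"
  shows "Sum_any (\<lambda>x. u x * lap m W F x) = Sum_any (\<lambda>x. F x * lap m W u x)"
    and "finite {x. lap m W u x \<noteq> 0}"
proof -
  define Y where "Y = {x. u x \<noteq> 0} \<union> (\<Union>x\<in>{x. u x \<noteq> 0}. nbhd x)"
  have Y: "finite Y" using u by (simp add: Y_def)
  have lap_u: "lap m W u y = (\<Sum>x\<in>Y. K y x * u x)" for y
    by (rule lap_eq_sum) (use Y in \<open>auto simp: Y_def\<close>)
  have supp: "{x. lap m W u x \<noteq> 0} \<subseteq> Y"
  proof clarify
    fix y assume "lap m W u y \<noteq> 0"
    then obtain x where "K y x * u x \<noteq> 0"
      unfolding lap_u by (meson sum.neutral)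
    then have "u x \<noteq> 0" "y \<in> nbhd x"
      using kirchhoff_nbhd[of x y] kirchhoff_sym by auto
    then show "y \<in> Y" by (auto simp: Y_def)
  qed
  then show "finite {x. lap m W u x \<noteq> 0}" using Y by (rule finite_subset)
  have "Sum_any (\<lambda>x. u x * lap m W F x) = (\<Sum>x\<in>Y. u x * lap m W F x)"
    by (rule Sum_any.expand_superset) (use Y in \<open>auto simp: Y_def\<close>)
  also have "\<dots> = (\<Sum>x\<in>Y. \<Sum>y\<in>Y. u x * K x y * F y)"
  proof (rule sum.cong)
    fix x
    show "u x * lap m W F x = (\<Sum>y\<in>Y. u x * K x y * F y)"
    proof (cases "u x = 0")
      case False
      then have "lap m W F x = (\<Sum>y\<in>Y. K x y * F y)"
        using kirchhoff_nbhd[of x] Y by (intro lap_eq_sum) (auto simp: Y_def)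
      then show ?thesis by (simp add: sum_distrib_left mult.assoc)
    qed simp
  qed simp
  also have "\<dots> = (\<Sum>y\<in>Y. F y * lap m W u y)"
    unfolding lap_u sum_distrib_left
    by (subst sum.swap) (simp add: kirchhoff_sym mult_ac)
  also have "\<dots> = Sum_any (\<lambda>x. F x * lap m W u x)"
    by (rule Sum_any.expand_superset[symmetric]) (use Y supp in auto)
  finally show "Sum_any (\<lambda>x. u x * lap m W F x) = Sum_any (\<lambda>x. F x * lap m W u x)" .
qed

end

section \<open>Poisson kernels and response matrices\<close>

lemma inverse_on_cong:
  assumes "\<And>u v. u \<in> I \<Longrightarrow> v \<in> I \<Longrightarrow> A u v = A' u v"
  shows "inverse_on I A = inverse_on I A'"
  unfolding inverse_on_def using assms by (simp cong: sum.cong)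

lemma lap_tendsto:
  assumes "\<And>x. x \<in> cover_vertices m \<Longrightarrow> (\<lambda>N. f N x) \<longlonglongrightarrow> g x"
  shows "(\<lambda>N. lap m W (f N) x) \<longlonglongrightarrow> lap m W g x"
proof (cases x)
  case (M k i)
  have "(\<lambda>N. f N (M j i')) \<longlonglongrightarrow> g (M j i')" if "j \<le> m" for j i'
    using assms that by (auto simp: cover_vertices_def)
  then show ?thesis
    unfolding lap_def M by (auto intro!: tendsto_intros)
qed

text \<open>
  The last clause replaces the uniqueness of bounded harmonic extensions: a finitely supported
  harmonic function solves the Dirichlet problem on all large truncations.
\<close>

definition poisson_kernel :: "nat \<Rightarrow> (edge \<Rightarrow> real) \<Rightarrow> (vertex \<Rightarrow> vertex \<Rightarrow> real) \<Rightarrow> bool" where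
  "poisson_kernel m W U \<longleftrightarrow>
     (\<forall>b\<in>boundary_vertices m. harmonic m W (U b) \<and>
        (\<forall>x\<in>boundary_vertices m. U b x = delta b x) \<and> (\<forall>x\<in>cover_vertices m. 0 \<le> U b x)) \<and>
     (\<forall>B x. finite B \<longrightarrow> B \<subseteq> boundary_vertices m \<longrightarrow> x \<in> cover_vertices m \<longrightarrow> (\<Sum>b\<in>B. U b x) \<le> 1) \<and>
     (\<forall>u B x. finite {x \<in> cover_vertices m. u x \<noteq> 0} \<longrightarrow> harmonic m W u \<longrightarrow>
        finite B \<longrightarrow> B \<subseteq> boundary_vertices m \<longrightarrow> (\<forall>x\<in>boundary_vertices m - B. u x = 0) \<longrightarrow>
        x \<in> cover_vertices m \<longrightarrow> u x = (\<Sum>b\<in>B. u b * U b x))"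

lemma poisson_kernelD:
  assumes "poisson_kernel m W U"
  shows "b \<in> boundary_vertices m \<Longrightarrow> harmonic m W (U b)"
    and "b \<in> boundary_vertices m \<Longrightarrow> x \<in> boundary_vertices m \<Longrightarrow> U b x = delta b x"
    and "b \<in> boundary_vertices m \<Longrightarrow> x \<in> cover_vertices m \<Longrightarrow> 0 \<le> U b x"
    and "finite B \<Longrightarrow> B \<subseteq> boundary_vertices m \<Longrightarrow> x \<in> cover_vertices m \<Longrightarrow> (\<Sum>b\<in>B. U b x) \<le> 1"
    and "finite {x \<in> cover_vertices m. u x \<noteq> 0} \<Longrightarrow> harmonic m W u \<Longrightarrow> finite B \<Longrightarrow>
      B \<subseteq> boundary_vertices m \<Longrightarrow> (\<And>x. x \<in> boundary_vertices m - B \<Longrightarrow> u x = 0) \<Longrightarrow>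
      x \<in> cover_vertices m \<Longrightarrow> u x = (\<Sum>b\<in>B. u b * U b x)"
  using assms[unfolded poisson_kernel_def, THEN conjunct1]
    assms[unfolded poisson_kernel_def, THEN conjunct2, THEN conjunct1, rule_format, of B x]
    assms[unfolded poisson_kernel_def, THEN conjunct2, THEN conjunct2, rule_format, of u B x]
  by simp_all

section \<open>Dirichlet problems on truncations and their monotone limit\<close>

context strip
begin

text \<open>Minimum principle. Choose a negative minimum in the leftmost possible column.
  Superharmonicity forces its straight left neighbour to attain the minimum too; being negative,
  that neighbour lies in \<open>I\<close>, contrary to the choice of column.\<close>

lemma nonneg_of_superharmonic:
  assumes I: "finite I" "I \<subseteq> cover_interior m"
    and lap: "\<And>x. x \<in> I \<Longrightarrow> lap m W f x \<le> 0"
    and off: "\<And>x. x \<in> cover_vertices m \<Longrightarrow> x \<notin> I \<Longrightarrow> f x \<ge> 0"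
    and "x \<in> cover_vertices m"
  shows "f x \<ge> 0"
proof (rule ccontr)
  assume neg: "\<not> f x \<ge> 0"
  define \<mu> where "\<mu> = Min (f ` I)"
  have xI: "x \<in> I" using off[of x] assms(5) neg by blast
  have "\<mu> \<le> f x" unfolding \<mu>_def using I(1) xI by simp
  then have \<mu>: "\<mu> < 0" using neg by simp
  have ge: "f y \<ge> \<mu>" if "y \<in> cover_vertices m" for y
    using off[OF that] \<mu> I(1) by (cases "y \<in> I") (auto simp: \<mu>_def)
  have "\<mu> \<in> f ` I" unfolding \<mu>_def using I(1) xI by (intro Min_in) auto
  then have "\<exists>k i. M k i \<in> I \<and> f (M k i) = \<mu>"
    by (metis imageE vertex.exhaust)
  define k where "k = (LEAST k. \<exists>i. M k i \<in> I \<and> f (M k i) = \<mu>)"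
  have "\<exists>i. M k i \<in> I \<and> f (M k i) = \<mu>"
    unfolding k_def by (rule LeastI_ex) fact
  then obtain i where i: "M k i \<in> I" "f (M k i) = \<mu>" by blast
  then obtain k' where k': "k = Suc k'" "Suc k' < m"
    using I(2) by (auto simp: cover_interior_def gr0_conv_Suc)
  have pos: "s k i > 0" "t k i > 0" "s k' i > 0" "t k' (i + 1) > 0"
    using k' straight_pos slanted_pos by auto
  have cov: "M (Suc k) i' \<in> cover_vertices m" "M k' i' \<in> cover_vertices m" for i'
    using k' by (auto simp: cover_vertices_def)
  have "s k i * (f (M (Suc k) i) - \<mu>) \<ge> 0" "t k i * (f (M (Suc k) (i - 1)) - \<mu>) \<ge> 0"
    "t k' (i + 1) * (f (M k' (i + 1)) - \<mu>) \<ge> 0"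
    using pos ge cov by simp_all
  moreover have "lap m W f (M k i) \<le> 0" using lap i(1) by blast
  ultimately have "s k' i * (f (M k' i) - \<mu>) \<le> 0"
    using lap_Suc[OF k'(2), of f i] i(2) by (simp add: k'(1))
  then have "f (M k' i) = \<mu>"
    using pos(3) ge[OF cov(2), of i] by (simp add: mult_le_0_iff)
  moreover have "M k' i \<in> I" using off[OF cov(2), of i] calculation \<mu> by auto
  ultimately have "k \<le> k'" unfolding k_def by (intro Least_le) auto
  then show False using k' by simp
qed

lemma zero_of_harmonic_on:
  assumes I: "finite I" "I \<subseteq> cover_interior m"
    and lap: "\<And>x. x \<in> I \<Longrightarrow> lap m W f x = 0"
    and off: "\<And>x. x \<in> cover_vertices m \<Longrightarrow> x \<notin> I \<Longrightarrow> f x = 0"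
    and x: "x \<in> cover_vertices m"
  shows "f x = 0"
proof -
  have "lap m W (\<lambda>x. - f x) y = - lap m W f y" for y
    using lap_linear[of m W "- 1" f 0 f y] by simp
  then have "0 \<le> - f x"
    by (intro nonneg_of_superharmonic[where f = "\<lambda>x. - f x", OF I _ _ x]) (simp_all add: lap off)
  moreover have "0 \<le> f x"
    by (rule nonneg_of_superharmonic[OF I _ _ x]) (simp_all add: lap off)
  ultimately show ?thesis by simp
qed

text \<open>The solution of the Dirichlet problem on the truncation with data
  \<open>delta v\<close>. Interior vertices of the cover outside \<open>S\<close> count as boundary
  and are held at 0; on the inside the formula is minus the inverse interior block applied to column
  \<open>v\<close>.\<close>

definition dirichlet :: "vertex set \<Rightarrow> vertex \<Rightarrow> vertex \<Rightarrow> real" where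
  "dirichlet S v x =
     (if x \<in> S \<inter> cover_interior m
      then - (\<Sum>y\<in>S \<inter> cover_interior m. inverse_on (S \<inter> cover_interior m) K x y * K y v)
      else delta v x)"

lemma dirichlet_off: "x \<notin> S \<inter> cover_interior m \<Longrightarrow> dirichlet S v x = delta v x"
  by (simp only: dirichlet_def if_False)

lemma interior_subset_cover: "cover_interior m \<subseteq> cover_vertices m"
  by (auto simp: cover_vertices_def cover_interior_def)

text \<open>The minimum principle supplies the injectivity needed for \<open>inverse_on\<close> to
  be a true inverse.\<close>

lemma kirchhoff_inverse:
  assumes I: "finite I" "I \<subseteq> cover_interior m" and "x \<in> I" "z \<in> I"
  shows "(\<Sum>y\<in>I. K x y * inverse_on I K y z) = (if x = z then 1 else 0)"
proof (rule inverse_on_symmetric)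
  fix g assume g: "\<And>u. u \<in> I \<Longrightarrow> (\<Sum>x\<in>I. K u x * g x) = 0"
  define h where "h x = (if x \<in> I then g x else 0)" for x
  have lap_h: "lap m W h x = 0" if "x \<in> I" for x
  proof -
    have "lap m W h x = (\<Sum>y\<in>I. K x y * h y)"
      by (rule lap_eq_sum) (use I in \<open>auto simp: h_def\<close>)
    then show ?thesis using g[OF that] by (simp add: h_def)
  qed
  have "h x = 0" if "x \<in> cover_vertices m" for x
    by (rule zero_of_harmonic_on[where f = h, OF I _ _ that]) (simp_all add: lap_h, simp add: h_def)
  then show "\<forall>u\<in>I. g u = 0"
    using I(2) interior_subset_cover by (metis h_def subsetD)
qed (use assms kirchhoff_sym in auto)

lemma lap_dirichlet_eq:
  assumes S: "finite S" and v: "v \<notin> cover_interior m"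
  shows "lap m W (dirichlet S v) x = K x v -
    (\<Sum>y\<in>S \<inter> cover_interior m. \<Sum>z\<in>S \<inter> cover_interior m.
      K x y * inverse_on (S \<inter> cover_interior m) K y z * K z v)"
proof -
  let ?I = "S \<inter> cover_interior m"
  have "lap m W (dirichlet S v) x = (\<Sum>y\<in>insert v ?I. K x y * dirichlet S v y)"
    by (rule lap_eq_sum) (use S in \<open>auto simp: dirichlet_def delta_def\<close>)
  also have "\<dots> = K x v + (\<Sum>y\<in>?I. K x y * dirichlet S v y)"
    using S v by (subst sum.insert) (auto simp: dirichlet_def delta_def)
  also have "(\<Sum>y\<in>?I. K x y * dirichlet S v y) =
      - (\<Sum>y\<in>?I. \<Sum>z\<in>?I. K x y * inverse_on ?I K y z * K z v)"
    by (simp add: dirichlet_def sum_distrib_left sum_negf mult.assoc)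
  finally show ?thesis by simp
qed

lemma lap_dirichlet_interior:
  assumes S: "finite S" and v: "v \<notin> cover_interior m" and x: "x \<in> S \<inter> cover_interior m"
  shows "lap m W (dirichlet S v) x = 0"
proof -
  let ?I = "S \<inter> cover_interior m"
  have "(\<Sum>y\<in>?I. \<Sum>z\<in>?I. K x y * inverse_on ?I K y z * K z v) =
      (\<Sum>z\<in>?I. (\<Sum>y\<in>?I. K x y * inverse_on ?I K y z) * K z v)"
    by (subst sum.swap) (simp add: sum_distrib_right)
  also have "\<dots> = (\<Sum>z\<in>?I. if z = x then K z v else 0)"
    by (rule sum.cong) (use S x in \<open>auto simp: kirchhoff_inverse\<close>)
  also have "\<dots> = K x v" using S x by simp
  finally show ?thesis by (simp add: lap_dirichlet_eq[OF S v])
qed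

lemma response_eq_lap_dirichlet:
  assumes S: "finite S" and uv: "u \<in> S" "v \<in> S" "v \<notin> cover_interior m"
  shows "response {e \<in> cover_edges m. ends e \<inter> S \<noteq> {}} ends W (S \<inter> cover_interior m) u v =
    lap m W (dirichlet S v) u"
proof -
  let ?A = "kirchhoff {e \<in> cover_edges m. ends e \<inter> S \<noteq> {}} ends W"
  \<comment> \<open>The truncation contains every edge incident to \<open>S\<close>, so its
    Kirchhoff matrix agrees with that of the whole cover as soon as one index lies in
    \<open>S\<close>.\<close>
  have A: "?A x y = K x y" if "x \<in> S \<or> y \<in> S" for x y
  proof -
    have "{e \<in> {e \<in> cover_edges m. ends e \<inter> S \<noteq> {}}. ends e = {x, y}} = {e \<in> cover_edges m. ends e = {x, y}}"
      "x = y \<Longrightarrow> {e \<in> {e \<in> cover_edges m. ends e \<inter> S \<noteq> {}}. x \<in> ends e} = {e \<in> cover_edges m. x \<in> ends e}"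
      using that by auto
    then show ?thesis unfolding kirchhoff_def by simp
  qed
  have "inverse_on (S \<inter> cover_interior m) ?A = inverse_on (S \<inter> cover_interior m) K"
    by (rule inverse_on_cong) (simp add: A)
  then show ?thesis
    using uv by (simp add: response_def schur_complement_def lap_dirichlet_eq[OF S uv(3)] A cong: sum.cong)
qed

lemma dirichlet_nonneg:
  assumes "finite S" "v \<notin> cover_interior m" "x \<in> cover_vertices m"
  shows "0 \<le> dirichlet S v x"
proof (rule nonneg_of_superharmonic[of "S \<inter> cover_interior m" "dirichlet S v"])
  show "lap m W (dirichlet S v) x \<le> 0" if "x \<in> S \<inter> cover_interior m" for x
    using lap_dirichlet_interior[OF assms(1,2) that] by simp
qed (use assms in \<open>auto simp: dirichlet_def delta_def\<close>)

text \<open>Enlarging \<open>S\<close> releases vertices that were held at 0, where the new solution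
  is nonnegative; the minimum principle on the smaller interior spreads the inequality.\<close>

lemma dirichlet_mono:
  assumes "finite S'" "S \<subseteq> S'" "v \<notin> cover_interior m" "x \<in> cover_vertices m"
  shows "dirichlet S v x \<le> dirichlet S' v x"
proof -
  have S: "finite S" using assms finite_subset by blast
  have "0 \<le> 1 * dirichlet S' v x + (- 1) * dirichlet S v x"
  proof (rule nonneg_of_superharmonic[of "S \<inter> cover_interior m" "\<lambda>x. 1 * dirichlet S' v x + (- 1) * dirichlet S v x"])
    show "lap m W (\<lambda>x. 1 * dirichlet S' v x + (- 1) * dirichlet S v x) x \<le> 0" if "x \<in> S \<inter> cover_interior m" for x
      unfolding lap_linear
      using lap_dirichlet_interior[OF assms(1,3), of x] lap_dirichlet_interior[OF S assms(3) that] that assms(2)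
      by auto
    show "0 \<le> 1 * dirichlet S' v x + (- 1) * dirichlet S v x"
      if "x \<in> cover_vertices m" "x \<notin> S \<inter> cover_interior m" for x
    proof (cases "x \<in> S' \<inter> cover_interior m")
      case True
      have "dirichlet S v x = 0"
        using that(2) True assms(3) by (auto simp: dirichlet_def delta_def)
      then show ?thesis using dirichlet_nonneg[OF assms(1,3) that(1)] by simp
    next
      case False
      then show ?thesis using that by (simp add: dirichlet_off)
    qed
  qed (use S assms in auto)
  then show ?thesis by simp
qed

lemma dirichlet_sum_le:
  assumes "finite S" "finite B" "B \<subseteq> boundary_vertices m" "x \<in> cover_vertices m"
  shows "(\<Sum>b\<in>B. dirichlet S b x) \<le> 1"
proof -
  have "0 \<le> 1 * 1 + (- 1) * (\<Sum>b\<in>B. 1 * dirichlet S b x)"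
  proof (rule nonneg_of_superharmonic[of "S \<inter> cover_interior m" "\<lambda>x. 1 * 1 + (- 1) * (\<Sum>b\<in>B. 1 * dirichlet S b x)"])
    show "lap m W (\<lambda>x. 1 * 1 + (- 1) * (\<Sum>b\<in>B. 1 * dirichlet S b x)) x \<le> 0" if "x \<in> S \<inter> cover_interior m" for x
    proof -
      have "lap m W (\<lambda>_. 1) x = 0" by (cases x) (simp add: lap_def)
      moreover have "lap m W (dirichlet S b) x = 0" if "b \<in> B" for b
        using lap_dirichlet_interior[OF assms(1) _ \<open>x \<in> _\<close>, of b] that assms(3) by auto
      ultimately show ?thesis
        unfolding lap_linear lap_sum[OF assms(2)] by simp
    qed
    show "0 \<le> 1 * 1 + (- 1) * (\<Sum>b\<in>B. 1 * dirichlet S b x)"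
      if "x \<in> cover_vertices m" "x \<notin> S \<inter> cover_interior m" for x
      using that assms(2) by (simp add: dirichlet_off delta_def)
  qed (use assms in auto)
  then show ?thesis by simp
qed

text \<open>Dirichlet solutions increase with the truncation and stay below 1, so they converge
  pointwise. The Laplacian sees finitely many values and passes to the limit; hence the limit
  defining the universal response exists and is a boundary current of \<open>U v\<close>.\<close>

lemma poisson_kernel_exists:
  assumes V: "exhaustion m V"
  obtains U where "poisson_kernel m W U"
    and "\<And>u v. u \<in> boundary_vertices m \<Longrightarrow> v \<in> boundary_vertices m \<Longrightarrow>
      (\<lambda>N. response {e \<in> cover_edges m. ends e \<inter> V N \<noteq> {}} ends W (V N \<inter> cover_interior m) u v)
        \<longlonglongrightarrow> lap m W (U v) u"
proof -
  have fin: "finite (V N)" and mono: "incseq V" and un: "(\<Union>N. V N) = cover_vertices m" for N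
    using V by (auto simp: exhaustion_def)
  have ev: "\<forall>\<^sub>F N in sequentially. x \<in> V N" if cov: "x \<in> cover_vertices m" for x
  proof -
    obtain N where "x \<in> V N" using cov unfolding un[symmetric] by blast
    then have "x \<in> V N'" if "N \<le> N'" for N'
      using incseqD[OF mono that] by blast
    then show ?thesis by (rule eventually_sequentiallyI)
  qed
  define U where "U v x = lim (\<lambda>N. dirichlet (V N) v x)" for v x
  have conv: "(\<lambda>N. dirichlet (V N) v x) \<longlonglongrightarrow> U v x" if "v \<in> boundary_vertices m" for v x
  proof (cases "x \<in> cover_vertices m")
    case True
    have "convergent (\<lambda>N. dirichlet (V N) v x)"
    proof (rule Bseq_mono_convergent)
      show "Bseq (\<lambda>N. dirichlet (V N) v x)"
        using dirichlet_nonneg[OF fin, of v x] dirichlet_sum_le[OF fin, of "{v}" x] that True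
        by (intro BseqI'[where K = 1]) auto
      show "\<forall>k n. k \<le> n \<longrightarrow> dirichlet (V k) v x \<le> dirichlet (V n) v x"
        using dirichlet_mono[OF fin] mono that True by (auto simp: incseq_def)
    qed
    then show ?thesis by (simp add: U_def convergent_LIMSEQ_iff)
  next
    case False
    then have "x \<notin> cover_interior m" using interior_subset_cover by blast
    then show ?thesis by (simp add: U_def dirichlet_off)
  qed
  have lap_conv: "(\<lambda>N. lap m W (dirichlet (V N) v) x) \<longlonglongrightarrow> lap m W (U v) x"
    if "v \<in> boundary_vertices m" for v x
    by (rule lap_tendsto) (rule conv[OF that])
  have "poisson_kernel m W U"
    unfolding poisson_kernel_def
  proof (intro conjI ballI allI impI)
    fix b assume b: "b \<in> boundary_vertices m"
    show "harmonic m W (U b)"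
      unfolding harmonic_def
    proof
      fix x assume x: "x \<in> cover_interior m"
      have cov: "x \<in> cover_vertices m" using x interior_subset_cover by blast
      have "\<forall>\<^sub>F N in sequentially. lap m W (dirichlet (V N) b) x = 0"
        by (rule eventually_mono[OF ev[OF cov]], rule lap_dirichlet_interior[OF fin]) (use b x in auto)
      then have "(\<lambda>N. lap m W (dirichlet (V N) b) x) \<longlonglongrightarrow> 0"
        by (rule tendsto_eventually)
      then show "lap m W (U b) x = 0"
        by (rule LIMSEQ_unique[OF lap_conv[OF b]])
    qed
    show "U b x = delta b x" if "x \<in> boundary_vertices m" for x
    proof -
      have "x \<notin> cover_interior m" using that by simp
      then show ?thesis by (simp add: U_def dirichlet_off)
    qed
    show "0 \<le> U b x" if "x \<in> cover_vertices m" for x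
      by (rule LIMSEQ_le_const[OF conv[OF b]]) (use dirichlet_nonneg[OF fin _ that] b in auto)
  next
    fix B x assume B: "finite B" "B \<subseteq> boundary_vertices m" "x \<in> cover_vertices m"
    have "(\<lambda>N. \<Sum>b\<in>B. dirichlet (V N) b x) \<longlonglongrightarrow> (\<Sum>b\<in>B. U b x)"
      by (intro tendsto_sum conv) (use B in auto)
    then show "(\<Sum>b\<in>B. U b x) \<le> 1"
      by (rule LIMSEQ_le_const2) (use dirichlet_sum_le[OF fin B] in auto)
  next
    fix u B x
    assume u: "finite {x \<in> cover_vertices m. u x \<noteq> 0}" "harmonic m W u"
      and B: "finite B" "B \<subseteq> boundary_vertices m" "\<forall>x\<in>boundary_vertices m - B. u x = 0"
      and x: "x \<in> cover_vertices m"
    have "\<forall>\<^sub>F N in sequentially. \<forall>y\<in>{x \<in> cover_vertices m. u x \<noteq> 0}. y \<in> V N"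
      using u(1) ev by (intro eventually_ball_finite) auto
    then have "\<forall>\<^sub>F N in sequentially. (\<Sum>b\<in>B. u b * dirichlet (V N) b x) = u x"
    proof (rule eventually_mono)
      fix N assume N: "\<forall>y\<in>{x \<in> cover_vertices m. u x \<noteq> 0}. y \<in> V N"
      have "1 * u x + (- 1) * (\<Sum>b\<in>B. u b * dirichlet (V N) b x) = 0"
      proof (rule zero_of_harmonic_on[of "V N \<inter> cover_interior m" "\<lambda>x. 1 * u x + (- 1) * (\<Sum>b\<in>B. u b * dirichlet (V N) b x)"])
        fix y assume y: "y \<in> V N \<inter> cover_interior m"
        have "lap m W (dirichlet (V N) b) y = 0" if "b \<in> B" for b
          using lap_dirichlet_interior[OF fin _ y, of b] that B(2) by auto
        then show "lap m W (\<lambda>x. 1 * u x + (- 1) * (\<Sum>b\<in>B. u b * dirichlet (V N) b x)) y = 0"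
          using u(2) y unfolding lap_linear lap_sum[OF B(1)] by (simp add: harmonic_def)
      next
        fix y assume y: "y \<in> cover_vertices m" "y \<notin> V N \<inter> cover_interior m"
        have "(\<Sum>b\<in>B. u b * dirichlet (V N) b y) = (\<Sum>b\<in>B. if b = y then u b else 0)"
          using y(2) by (intro sum.cong) (auto simp: dirichlet_def delta_def)
        also have "\<dots> = u y"
          using B y N by (cases "y \<in> cover_interior m") auto
        finally show "1 * u y + (- 1) * (\<Sum>b\<in>B. u b * dirichlet (V N) b y) = 0" by simp
      qed (use fin x in auto)
      then show "(\<Sum>b\<in>B. u b * dirichlet (V N) b x) = u x" by simp
    qed
    then have "(\<lambda>N. \<Sum>b\<in>B. u b * dirichlet (V N) b x) \<longlonglongrightarrow> u x"
      by (rule tendsto_eventually)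
    moreover have "(\<lambda>N. \<Sum>b\<in>B. u b * dirichlet (V N) b x) \<longlonglongrightarrow> (\<Sum>b\<in>B. u b * U b x)"
      by (intro tendsto_intros conv) (use B in auto)
    ultimately show "u x = (\<Sum>b\<in>B. u b * U b x)" by (rule LIMSEQ_unique)
  qed
  moreover have "(\<lambda>N. response {e \<in> cover_edges m. ends e \<inter> V N \<noteq> {}} ends W (V N \<inter> cover_interior m) u v)
        \<longlonglongrightarrow> lap m W (U v) u"
    if "u \<in> boundary_vertices m" "v \<in> boundary_vertices m" for u v
  proof (rule Lim_transform_eventually[OF lap_conv[OF that(2)]])
    have "\<forall>\<^sub>F N in sequentially. u \<in> V N \<and> v \<in> V N"
      using ev that by (auto intro: eventually_conj)
    then show "\<forall>\<^sub>F N in sequentially. lap m W (dirichlet (V N) v) u =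
        response {e \<in> cover_edges m. ends e \<inter> V N \<noteq> {}} ends W (V N \<inter> cover_interior m) u v"
      by (rule eventually_mono) (use response_eq_lap_dirichlet[OF fin] that in auto)
  qed
  ultimately show ?thesis by (rule that)
qed

end

section \<open>Transfer of Cauchy data\<close>

lemma lap_cover_cong:
  assumes "\<And>x. x \<in> cover_vertices m \<Longrightarrow> f x = g x"
  shows "lap m W f x = lap m W g x"
proof (cases x)
  case (M k i)
  have "f (M j i') = g (M j i')" if "j \<le> m" for j i'
    using assms that by (auto simp: cover_vertices_def)
  then show ?thesis unfolding lap_def M by simp
qed

lemma lap_outside_cover: "x \<notin> cover_vertices m \<Longrightarrow> lap m W f x = 0"
  by (cases x) (auto simp: lap_def cover_vertices_def)

lemma boundary_vertices_iff:
  "M k i \<in> boundary_vertices m \<longleftrightarrow> k = 0 \<or> k = m"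
  by (auto simp: cover_vertices_def cover_interior_def)

definition left_mode :: "(int \<Rightarrow> real) \<Rightarrow> vertex \<Rightarrow> real" where
  "left_mode H x = (case x of M k i \<Rightarrow> if k = 0 then alt i * H i else 0)"

context strip
begin

text \<open>
  Prescribing the Cauchy data gives an infinite linear system with finite rows.  It is solvable as soon as
  the right-hand sides respect every finite linear relation between the rows, and these relations
  are the finitely supported harmonic functions.
\<close>

lemma harmonic_with_cauchy_data:
  assumes compat: "\<And>a. finite {x. a x \<noteq> 0} \<Longrightarrow> {x. a x \<noteq> 0} \<subseteq> cover_vertices m \<Longrightarrow> harmonic m W a \<Longrightarrow>
    Sum_any (\<lambda>x. if x \<in> boundary_vertices m then a x * \<kappa> x - f x * lap m W a x else 0) = 0"
  obtains F where "harmonic m W F"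
    and "\<And>x. x \<in> boundary_vertices m \<Longrightarrow> F x = f x"
    and "\<And>x. x \<in> boundary_vertices m \<Longrightarrow> lap m W F x = \<kappa> x"
proof -
  define f0 where "f0 x = (if x \<in> boundary_vertices m then f x else 0)" for x
  \<comment> \<open>The right-hand sides left for the unknown interior values after the prescribed
    boundary values have been moved across.\<close>
  define r where "r x = (if x \<in> boundary_vertices m then \<kappa> x else 0) - lap m W f0 x" for x
  define V where "V = {a :: vertex \<Rightarrow> real. finite {x. a x \<noteq> 0} \<and> {x. a x \<noteq> 0} \<subseteq> cover_vertices m}"
  \<comment> \<open>By symmetry of the Kirchhoff matrix, \<open>T a\<close> lists the coefficients
    with which the interior unknowns occur in the combination \<open>a\<close> of rows;
    \<open>\<rho> a\<close> is the same combination of right-hand sides.\<close>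
  define T where "T a y = (if y \<in> cover_interior m then lap m W a y else 0)" for a y
  define \<rho> where "\<rho> a = Sum_any (\<lambda>x. a x * r x)" for a
  have \<rho>_eq: "\<rho> a = (\<Sum>x\<in>A. a x * r x)" if "finite A" "{x. a x \<noteq> 0} \<subseteq> A" for a A
    unfolding \<rho>_def by (rule Sum_any.expand_superset) (use that in auto)
  obtain \<phi> where \<phi>: "\<And>c d f g. \<phi> (\<lambda>x. c * f x + d * g x) = c * \<phi> f + d * \<phi> g"
    "\<And>a. a \<in> V \<Longrightarrow> \<phi> (T a) = \<rho> a"
  proof (rule linear_functional_factors[of T V \<rho>])
    show "T (\<lambda>x. c * f x + d * g x) y = c * T f y + d * T g y" for c f d g y
      by (simp add: T_def lap_linear)
    show "(\<lambda>_. 0) \<in> V" by (simp add: V_def)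
    show "(\<lambda>x. c * f x + d * g x) \<in> V" if "f \<in> V" "g \<in> V" for c d f g
    proof -
      have "{x. c * f x + d * g x \<noteq> 0} \<subseteq> {x. f x \<noteq> 0} \<union> {x. g x \<noteq> 0}" by auto
      with that show ?thesis unfolding V_def by (auto dest: finite_subset)
    qed
    show "\<rho> (\<lambda>x. c * f x + d * g x) = c * \<rho> f + d * \<rho> g" if "f \<in> V" "g \<in> V" for c d f g
    proof -
      define A where "A = {x. f x \<noteq> 0} \<union> {x. g x \<noteq> 0}"
      have A: "finite A" "{x. f x \<noteq> 0} \<subseteq> A" "{x. g x \<noteq> 0} \<subseteq> A" "{x. c * f x + d * g x \<noteq> 0} \<subseteq> A"
        using that by (auto simp: A_def V_def)
      show ?thesis
        unfolding \<rho>_eq[OF A(1,2)] \<rho>_eq[OF A(1,3)] \<rho>_eq[OF A(1,4)]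
        by (simp add: sum_distrib_left sum.distrib algebra_simps)
    qed
    show "\<rho> a = 0" if a: "a \<in> V" "\<And>y. T a y = 0" for a
    proof -
      have fin: "finite {x. a x \<noteq> 0}" "{x. a x \<noteq> 0} \<subseteq> cover_vertices m" using a(1) by (auto simp: V_def)
      have harm: "harmonic m W a" unfolding harmonic_def using a(2) by (metis T_def)
      define A where "A = {x. a x \<noteq> 0} \<union> {x. lap m W a x \<noteq> 0}"
      have A: "finite A" using green_identity(2)[OF fin(1)] fin(1) by (simp add: A_def)
      have "(\<Sum>x\<in>A. a x * lap m W f0 x) = Sum_any (\<lambda>x. a x * lap m W f0 x)"
        by (rule Sum_any.expand_superset[symmetric]) (use A in \<open>auto simp: A_def\<close>)
      also have "\<dots> = Sum_any (\<lambda>x. f0 x * lap m W a x)" by (rule green_identity(1)[OF fin(1)])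
      also have "\<dots> = (\<Sum>x\<in>A. f0 x * lap m W a x)"
        by (rule Sum_any.expand_superset) (use A in \<open>auto simp: A_def\<close>)
      finally have green: "(\<Sum>x\<in>A. a x * lap m W f0 x) = (\<Sum>x\<in>A. f0 x * lap m W a x)" .
      have "\<rho> a = (\<Sum>x\<in>A. a x * (if x \<in> boundary_vertices m then \<kappa> x else 0)) - (\<Sum>x\<in>A. a x * lap m W f0 x)"
        unfolding \<rho>_eq[OF A, of a, unfolded A_def, OF Un_upper1, folded A_def] r_def
        by (simp add: right_diff_distrib sum_subtractf)
      also have "\<dots> = (\<Sum>x\<in>A. if x \<in> boundary_vertices m then a x * \<kappa> x - f x * lap m W a x else 0)"
        unfolding green sum_subtractf[symmetric] f0_def by (rule sum.cong) auto
      also have "\<dots> = Sum_any (\<lambda>x. if x \<in> boundary_vertices m then a x * \<kappa> x - f x * lap m W a x else 0)"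
        by (rule Sum_any.expand_superset[symmetric]) (use A in \<open>auto simp: A_def\<close>)
      also have "\<dots> = 0" by (rule compat[OF fin harm])
      finally show ?thesis .
    qed
  qed blast
  \<comment> \<open>The unknown at \<open>x\<close> is the value of \<open>\<phi>\<close> on its
    coordinate vector. Row \<open>x\<close> involves finitely many unknowns, so linearity of
    \<open>\<phi>\<close> recovers its equation.\<close>
  define G where "G x = (if x \<in> cover_interior m then \<phi> (delta x) else 0)" for x
  define F where "F x = 1 * f0 x + 1 * G x" for x
  have lap_F: "lap m W F x = (if x \<in> boundary_vertices m then \<kappa> x else 0)" if x: "x \<in> cover_vertices m" for x
  proof -
    let ?N = "nbhd x \<inter> cover_interior m"
    have "T (delta x) = (\<lambda>y. \<Sum>z\<in>?N. K x z * delta z y)"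
    proof
      fix y
      have "(\<Sum>z\<in>?N. K x z * delta z y) = (\<Sum>z\<in>?N. if z = y then K x z else 0)"
        by (rule sum.cong) (auto simp: delta_def)
      also have "\<dots> = T (delta x) y"
        using kirchhoff_nbhd[of x y] by (auto simp: T_def kirchhoff_eq_lap[symmetric] kirchhoff_sym[of y x])
      finally show "T (delta x) y = (\<Sum>z\<in>?N. K x z * delta z y)" ..
    qed
    then have "\<phi> (T (delta x)) = (\<Sum>z\<in>?N. K x z * \<phi> (delta z))"
      using linear_functional_sum[of \<phi> ?N "K x" delta] \<phi>(1) by simp
    also have "\<dots> = (\<Sum>z\<in>?N. K x z * G z)" by (rule sum.cong) (auto simp: G_def)
    also have "\<dots> = lap m W G x"
      by (rule lap_eq_sum[symmetric]) (use kirchhoff_nbhd[of x] in \<open>auto simp: G_def\<close>)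
    finally have "lap m W G x = \<rho> (delta x)"
      using \<phi>(2)[of "delta x"] x by (simp add: V_def delta_def)
    also have "\<dots> = r x" using \<rho>_eq[of "{x}" "delta x"] by (auto simp: delta_def)
    finally show ?thesis unfolding F_def lap_linear r_def by simp
  qed
  show ?thesis
  proof (rule that[of F])
    show "harmonic m W F"
      using lap_F interior_subset_cover by (auto simp: harmonic_def)
  qed (use lap_F in \<open>auto simp: F_def G_def f0_def\<close>)
qed

lemma slanted_mode:
  obtains H where "\<And>i. H i > 0" "\<And>i. t 0 (i + 1) * H (i + 1) = s 0 i * H i"
proof -
  have pos: "s 0 i > 0" "t 0 i > 0" for i
    using straight_pos slanted_pos m_pos by auto
  obtain H where H: "\<And>i. H i > 0" "\<And>i. H (i + 1) = (s 0 i / t 0 (i + 1)) * H i"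
    by (rule int_recursion_exists[of "\<lambda>i. s 0 i / t 0 (i + 1)"]) (use pos in auto)
  have "t 0 (i + 1) * H (i + 1) = s 0 i * H i" for i
    using H(2)[of i] pos(2)[of "i + 1"] by (simp add: field_simps)
  with H(1) show ?thesis by (rule that)
qed

text \<open>The two contributions at column 1 cancel by the recursion for \<open>H\<close>. For
  \<open>m = 1\<close> that column is the right boundary, and the cancellation says that its current
  is zero.\<close>

lemma lap_left_mode:
  assumes "\<And>i. t 0 (i + 1) * H (i + 1) = s 0 i * H i"
  shows "lap m W (left_mode H) (M k i) = (if k = 0 then - (s 0 i + t 0 i) * (alt i * H i) else 0)"
proof (cases "k = 1")
  case True
  have "s 0 i * (alt i * H i) + t 0 (i + 1) * (- alt i * H (i + 1)) =
      alt i * (s 0 i * H i - t 0 (i + 1) * H (i + 1))"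
    by (simp add: algebra_simps)
  also have "\<dots> = 0" by (simp add: assms)
  finally show ?thesis using True m_pos by (auto simp: lap_def left_mode_def)
next
  case False
  then show ?thesis using m_pos by (auto simp: lap_def left_mode_def algebra_simps)
qed

end

text \<open>Stated through Poisson kernels, so that exhaustions disappear and the two networks may
  have been exhausted differently.\<close>

definition same_response :: "nat \<Rightarrow> (edge \<Rightarrow> real) \<Rightarrow> (edge \<Rightarrow> real) \<Rightarrow> bool" where
  "same_response m W W' \<longleftrightarrow> (\<exists>U U'. poisson_kernel m W U \<and> poisson_kernel m W' U' \<and>
     (\<forall>u\<in>boundary_vertices m. \<forall>v\<in>boundary_vertices m. lap m W (U v) u = lap m W' (U' v) u))"

lemma same_response_sym: "same_response m W W' \<Longrightarrow> same_response m W' W"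
  unfolding same_response_def by (metis (no_types))

text \<open>The equations for \<open>F'\<close> are solvable if every finitely supported harmonic
  \<open>a\<close> of the second network passes the compatibility test. Such an \<open>a\<close> has
  a counterpart \<open>u\<close> in the first network with the same Cauchy data, and Green's
  identity between \<open>u\<close> and \<open>F\<close> is exactly that test.\<close>

lemma cauchy_data_transfer:
  assumes "strip n m W" "strip n m W'" and sorted: "strip.sorted_radii n m W"
    and same: "same_response m W W'" and F: "harmonic m W F"
  obtains F' where "harmonic m W' F'"
    and "\<And>x. x \<in> boundary_vertices m \<Longrightarrow> F' x = F x"
    and "\<And>x. x \<in> boundary_vertices m \<Longrightarrow> lap m W' F' x = lap m W F x"
proof -
  interpret N: strip n m W by fact
  interpret N': strip n m W' by fact
  obtain U U' where U: "poisson_kernel m W U" "poisson_kernel m W' U'"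
    and eq: "\<And>u v. u \<in> boundary_vertices m \<Longrightarrow> v \<in> boundary_vertices m \<Longrightarrow>
      lap m W (U v) u = lap m W' (U' v) u"
    using same unfolding same_response_def by blast
  show ?thesis
  proof (rule N'.harmonic_with_cauchy_data[of "lap m W F" F])
    fix a assume a: "finite {x. a x \<noteq> 0}" "{x. a x \<noteq> 0} \<subseteq> cover_vertices m" "harmonic m W' a"
    define B where "B = {x \<in> boundary_vertices m. a x \<noteq> 0}"
    have B: "finite B" "B \<subseteq> boundary_vertices m" using a(1) by (auto simp: B_def)
    define u where "u x = (\<Sum>b\<in>B. a b * U b x)" for x
    have lap_u: "lap m W u x = (\<Sum>b\<in>B. a b * lap m W (U b) x)" for x
      unfolding u_def by (rule lap_sum[OF B(1)])
    have lap_a: "lap m W' a x = (\<Sum>b\<in>B. a b * lap m W' (U' b) x)" for x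
    proof -
      have "a y = (\<Sum>b\<in>B. a b * U' b y)" if "y \<in> cover_vertices m" for y
        by (rule poisson_kernelD(5)[OF U(2) _ a(3) B _ that]) (use a in \<open>auto simp: B_def\<close>)
      then have "lap m W' a x = lap m W' (\<lambda>y. \<Sum>b\<in>B. a b * U' b y) x"
        by (rule lap_cover_cong)
      then show ?thesis by (simp add: lap_sum[OF B(1)])
    qed
    have lap_ua: "lap m W u x = lap m W' a x" if "x \<in> boundary_vertices m" for x
      unfolding lap_u lap_a using eq that B(2) by (intro sum.cong) auto
    have u_harm: "harmonic m W u"
      using poisson_kernelD(1)[OF U(1)] B(2) by (auto simp: harmonic_def lap_u intro!: sum.neutral)
    have u_bd: "u x = a x" if "x \<in> boundary_vertices m" for x
    proof -
      have "u x = (\<Sum>b\<in>B. if b = x then a b else 0)"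
        unfolding u_def using poisson_kernelD(2)[OF U(1) _ that] B(2)
        by (intro sum.cong) (auto simp: delta_def)
      also have "\<dots> = a x" using B(1) that by (auto simp: B_def)
      finally show ?thesis .
    qed
    have inj: "inj (M k)" for k by (simp add: inj_on_def)
    have lap_a_fin: "finite {x. lap m W' a x \<noteq> 0}" by (rule N'.green_identity(2)[OF a(1)])
    \<comment> \<open>Green's identity with the arbitrary function \<open>F\<close> demands finite
      support; here the sorted radii provide it.\<close>
    have fin: "finite {x \<in> cover_vertices m. u x \<noteq> 0}"
    proof (rule N.finite_support_of_finite_cauchy_data[OF sorted u_harm])
      have "{i. u (M 0 i) \<noteq> 0} = M 0 -` {x. a x \<noteq> 0}" "{i. u (M m i) \<noteq> 0} = M m -` {x. a x \<noteq> 0}"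
        "{i. lap m W u (M 0 i) \<noteq> 0} = M 0 -` {x. lap m W' a x \<noteq> 0}"
        using u_bd[of "M 0 _"] u_bd[of "M m _"] lap_ua[of "M 0 _"] by (auto simp: boundary_vertices_iff simp del: Diff_iff)
      then show "finite {i. u (M 0 i) \<noteq> 0}" "finite {i. u (M m i) \<noteq> 0}"
        "finite {i. lap m W u (M 0 i) \<noteq> 0}"
        using finite_vimageI[OF a(1) inj] finite_vimageI[OF lap_a_fin inj] by auto
    qed
    \<comment> \<open>A Poisson kernel is unconstrained outside the cover, so \<open>u\<close> is
      cut off there to be finitely supported on the whole vertex type.\<close>
    define v where "v x = (if x \<in> cover_vertices m then u x else 0)" for x
    have v_fin: "finite {x. v x \<noteq> 0}" by (rule finite_subset[OF _ fin]) (auto simp: v_def)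
    have lap_v: "lap m W v x = lap m W u x" for x
      by (rule lap_cover_cong) (simp add: v_def)
    define A where "A = {x. v x \<noteq> 0} \<union> {x. lap m W v x \<noteq> 0}"
    have A: "finite A" using v_fin N.green_identity(2)[OF v_fin] by (simp add: A_def)
    have "(\<Sum>x. if x \<in> boundary_vertices m then a x * lap m W F x - F x * lap m W' a x else 0) =
        (\<Sum>x. v x * lap m W F x - F x * lap m W v x)"
    proof (rule Sum_any.cong)
      fix x
      consider "x \<in> boundary_vertices m" | "x \<in> cover_interior m" | "x \<notin> cover_vertices m" by blast
      then show "(if x \<in> boundary_vertices m then a x * lap m W F x - F x * lap m W' a x else 0) =
          v x * lap m W F x - F x * lap m W v x"
      proof cases
        case 1
        then show ?thesis using u_bd lap_ua by (simp add: lap_v v_def)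
      next
        case 2
        then show ?thesis using F u_harm by (simp add: lap_v harmonic_def)
      next
        case 3
        then show ?thesis by (simp add: lap_outside_cover)
      qed
    qed
    also have "\<dots> = (\<Sum>x\<in>A. v x * lap m W F x - F x * lap m W v x)"
      by (rule Sum_any.expand_superset) (use A in \<open>auto simp: A_def\<close>)
    also have "\<dots> = (\<Sum>x\<in>A. v x * lap m W F x) - (\<Sum>x\<in>A. F x * lap m W v x)"
      by (rule sum_subtractf)
    also have "(\<Sum>x\<in>A. v x * lap m W F x) = (\<Sum>x. v x * lap m W F x)"
      by (rule Sum_any.expand_superset[symmetric]) (use A in \<open>auto simp: A_def\<close>)
    also have "(\<Sum>x\<in>A. F x * lap m W v x) = (\<Sum>x. F x * lap m W v x)"
      by (rule Sum_any.expand_superset[symmetric]) (use A in \<open>auto simp: A_def\<close>)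
    also have "(\<Sum>x. v x * lap m W F x) - (\<Sum>x. F x * lap m W v x) = 0"
      using N.green_identity(1)[OF v_fin, of F] by simp
    finally show "(\<Sum>x. if x \<in> boundary_vertices m then a x * lap m W F x - F x * lap m W' a x else 0) = 0" .
  qed (rule that)
qed

text \<open>The mode of the first network has zero Cauchy data on the right, and so has its transfer
  to the second. If the transfer also lives on the left boundary, its equation at column 1 compares
  the ratios and its current at column 0 the sums. Otherwise its boundary values, of modulus
  \<open>H\<close>, dominate \<open>H'\<close>.\<close>

lemma left_mode_dichotomy:
  assumes strips: "strip n m W" "strip n m W'"
    and sorted: "strip.sorted_radii n m W" "strip.sorted_radii n m W'"
    and same: "same_response m W W'"
    and H: "\<And>i. H i > 0" "\<And>i. W (Slanted 0 (i + 1)) * H (i + 1) = W (Straight 0 i) * H i"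
    and H': "\<And>i. H' i > 0" "\<And>i. W' (Slanted 0 (i + 1)) * H' (i + 1) = W' (Straight 0 i) * H' i"
  shows "(\<forall>i. W' (Straight 0 i) * W (Slanted 0 (i + 1)) = W (Straight 0 i) * W' (Slanted 0 (i + 1)) \<and>
      W' (Straight 0 i) + W' (Slanted 0 i) = W (Straight 0 i) + W (Slanted 0 i)) \<or> dominates H H'"
proof -
  interpret N: strip n m W by fact
  interpret N': strip n m W' by fact
  let ?F = "left_mode H"
  have "harmonic m W ?F"
    by (auto simp: harmonic_def cover_interior_def N.lap_left_mode[OF H(2)])
  then obtain F where F: "harmonic m W' F" "\<And>x. x \<in> boundary_vertices m \<Longrightarrow> F x = ?F x"
    "\<And>x. x \<in> boundary_vertices m \<Longrightarrow> lap m W' F x = lap m W ?F x"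
    using cauchy_data_transfer[OF strips sorted(1) same] by blast
  have F0: "F (M 0 i) = alt i * H i" "lap m W' F (M 0 i) = - (N.s 0 i + N.t 0 i) * (alt i * H i)"
    and Fm: "F (M m i) = 0" "lap m W' F (M m i) = 0" for i
    using N.m_pos F(2)[of "M 0 i"] F(3)[of "M 0 i"] F(2)[of "M m i"] F(3)[of "M m i"]
    unfolding boundary_vertices_iff N.lap_left_mode[OF H(2)] by (simp_all add: left_mode_def)
  have "F (M 0 0) \<noteq> 0" using H(1)[of 0] by (simp add: F0)
  from N'.right_zero_dichotomy[OF sorted(2) F(1) Fm this H']
  show ?thesis
  proof
    assume zero: "\<forall>j i. 1 \<le> j \<longrightarrow> j \<le> m \<longrightarrow> F (M j i) = 0"
    have "N'.s 0 i * N.t 0 (i + 1) = N.s 0 i * N'.t 0 (i + 1) \<and>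
      N'.s 0 i + N'.t 0 i = N.s 0 i + N.t 0 i" for i
    proof
      have lap1: "lap m W' F (M 1 i) = 0"
        using harmonicD[OF F(1), of 1 i] Fm(2)[of i] N.m_pos by (cases "m = 1") auto
      have "F (M 1 i) = 0" "m \<noteq> 1 \<Longrightarrow> F (M 2 i) = 0" "m \<noteq> 1 \<Longrightarrow> F (M 2 (i - 1)) = 0"
        using zero N.m_pos by auto
      then have "N'.s 0 i * F (M 0 i) + N'.t 0 (i + 1) * F (M 0 (i + 1)) = 0"
        using lap1 N.m_pos by (auto simp: lap_def numeral_2_eq_2 split: if_splits)
      then have "alt i * (N'.s 0 i * H i - N'.t 0 (i + 1) * H (i + 1)) = 0"
        by (simp add: F0 algebra_simps)
      then have 1: "N'.s 0 i * H i = N'.t 0 (i + 1) * H (i + 1)" by simp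
      have "(N'.s 0 i * N.t 0 (i + 1) - N.s 0 i * N'.t 0 (i + 1)) * (H i * H (i + 1)) =
          (N'.s 0 i * H i) * (N.t 0 (i + 1) * H (i + 1)) - (N.s 0 i * H i) * (N'.t 0 (i + 1) * H (i + 1))"
        by (simp add: algebra_simps)
      also have "\<dots> = 0" unfolding 1 H(2) by simp
      finally show "N'.s 0 i * N.t 0 (i + 1) = N.s 0 i * N'.t 0 (i + 1)"
        using H(1)[of i] H(1)[of "i + 1"] by simp
      have "F (M 1 i) = 0" "F (M 1 (i - 1)) = 0" using zero N.m_pos by auto
      then have "- (N'.s 0 i + N'.t 0 i) * (alt i * H i) = - (N.s 0 i + N.t 0 i) * (alt i * H i)"
        using F0(2)[of i] unfolding N'.lap_left F0(1) by (simp add: algebra_simps)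
      then show "N'.s 0 i + N'.t 0 i = N.s 0 i + N.t 0 i"
        using H(1)[of i] by simp
    qed
    then show ?thesis by blast
  next
    assume "dominates (\<lambda>i. \<bar>F (M 0 i)\<bar>) H'"
    moreover have "(\<lambda>i. \<bar>F (M 0 i)\<bar>) = H"
      using H(1) by (simp add: F0 abs_mult less_imp_le)
    ultimately show ?thesis by simp
  qed
qed

text \<open>The dichotomy is applied in both directions. If both ended in domination, each of two
  positive functions would eventually be at least twice the other. The relation itself is symmetric
  in the networks, so either direction suffices.\<close>

lemma left_layer_relation:
  assumes strips: "strip n m W" "strip n m W'"
    and sorted: "strip.sorted_radii n m W" "strip.sorted_radii n m W'"
    and same: "same_response m W W'"
  shows "W' (Straight 0 i) * W (Slanted 0 (i + 1)) = W (Straight 0 i) * W' (Slanted 0 (i + 1))"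
    and "W' (Straight 0 i) + W' (Slanted 0 i) = W (Straight 0 i) + W (Slanted 0 i)"
proof -
  obtain H where H: "\<And>i. H i > 0" "\<And>i. W (Slanted 0 (i + 1)) * H (i + 1) = W (Straight 0 i) * H i"
    using strip.slanted_mode[OF strips(1)] by blast
  obtain H' where H': "\<And>i. H' i > 0" "\<And>i. W' (Slanted 0 (i + 1)) * H' (i + 1) = W' (Straight 0 i) * H' i"
    using strip.slanted_mode[OF strips(2)] by blast
  have "\<not> (dominates H H' \<and> dominates H' H)"
  proof
    assume "dominates H H' \<and> dominates H' H"
    then obtain a b where "\<And>l. l \<ge> a \<Longrightarrow> H l \<ge> 2 * H' l" "\<And>l. l \<ge> b \<Longrightarrow> H' l \<ge> 2 * H l"
      unfolding dominates_def by meson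
    from this(1)[of "max a b"] this(2)[of "max a b"] H(1)[of "max a b"] show False by simp
  qed
  then have "\<forall>i. W' (Straight 0 i) * W (Slanted 0 (i + 1)) = W (Straight 0 i) * W' (Slanted 0 (i + 1)) \<and>
      W' (Straight 0 i) + W' (Slanted 0 i) = W (Straight 0 i) + W (Slanted 0 i)"
    using left_mode_dichotomy[OF strips sorted same H H']
      left_mode_dichotomy[OF strips(2,1) sorted(2,1) same_response_sym[OF same] H' H]
    by (metis mult.commute)
  then show "W' (Straight 0 i) * W (Slanted 0 (i + 1)) = W (Straight 0 i) * W' (Slanted 0 (i + 1))"
    "W' (Straight 0 i) + W' (Slanted 0 i) = W (Straight 0 i) + W (Slanted 0 i)"
    by auto
qed

section \<open>Conductances of the first layer\<close>

context strip
begin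

text \<open>\<open>p\<close> is a uniform lower bound for the probability that the random walk in an
  interior vertex steps along the straight edge to its left; periodicity makes it uniform in
  \<open>i\<close>.\<close>

lemma left_conductance_bound:
  "\<exists>p>0. p \<le> 1 \<and>
    (\<forall>k i. Suc k < m \<longrightarrow> p * (s (Suc k) i + t (Suc k) i + s k i + t k (i + 1)) \<le> s k i)"
proof -
  have "\<exists>c>0. \<forall>i. c * (s (Suc k) i + t (Suc k) i + s k i + t k (i + 1)) \<le> s k i" if k: "Suc k < m" for k
  proof -
    define D where "D i = s (Suc k) i + t (Suc k) i + s k i + t k (i + 1)" for i
    have pos: "s k i > 0" "D i > 0" for i
      using k straight_pos[of k] straight_pos[of "Suc k"] slanted_pos[of k] slanted_pos[of "Suc k"]
      by (auto simp: D_def intro!: add_pos_pos)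
    define r where "r i = s k i / D i" for i
    have per: "r (i + int n) = r i" for i
      using straight_periodic[of k i] straight_periodic[of "Suc k" i] slanted_periodic[of "Suc k" i]
        slanted_periodic[of k "i + 1"]
      by (simp add: r_def D_def algebra_simps)
    obtain c where c: "c > 0" "\<And>i. i \<ge> 0 \<Longrightarrow> r i \<ge> c"
      by (rule periodic_positive_lower_bound[OF n_pos, of r 0]) (use pos per in \<open>auto simp: r_def\<close>)
    have "c * D i \<le> s k i" for i
    proof -
      have "c \<le> r (i mod int n)" using c(2) n_pos by simp
      also have "\<dots> = r i" by (rule periodic_mod[of r, OF per])
      finally show ?thesis using pos by (simp add: r_def field_simps)
    qed
    with c(1) show ?thesis unfolding D_def by blast
  qed
  then obtain c where c: "\<And>k. Suc k < m \<Longrightarrow> c k > 0"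
    "\<And>k i. Suc k < m \<Longrightarrow> c k * (s (Suc k) i + t (Suc k) i + s k i + t k (i + 1)) \<le> s k i"
    by metis
  \<comment> \<open>Inserting 1 gives \<open>p \<le> 1\<close> and keeps the set nonempty when there
    are no interior columns.\<close>
  define C where "C = insert 1 (c ` {k. Suc k < m})"
  have "finite {k. Suc k < m}" by (rule finite_subset[of _ "{..<m}"]) auto
  then have C: "finite C" "C \<noteq> {}" by (auto simp: C_def)
  show ?thesis
  proof (intro exI[of _ "Min C"] conjI allI impI)
    show "0 < Min C" using C c(1) by (auto simp: C_def)
    show "Min C \<le> 1" using C by (auto simp: C_def)
    fix k i assume k: "Suc k < m"
    then have "Min C \<le> c k" using C(1) by (intro Min_le) (auto simp: C_def)
    moreover have "s (Suc k) i + t (Suc k) i + s k i + t k (i + 1) > 0"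
      using k straight_pos[of k] straight_pos[of "Suc k"] slanted_pos[of k] slanted_pos[of "Suc k"]
      by (auto intro!: add_pos_pos)
    ultimately show "Min C * (s (Suc k) i + t (Suc k) i + s k i + t k (i + 1)) \<le> s k i"
      using c(2)[OF k, of i] by (meson mult_right_mono less_imp_le order_trans)
  qed
qed

text \<open>From column \<open>k\<close> the random walk reaches the left boundary along straight
  edges with probability at least \<open>p ^ k\<close>, so zero boundary values shrink a bound by
  \<open>1 - p ^ m\<close>. Each such gain costs at most \<open>m\<close> indices, and
  \<open>r\<close> gains give the power. The factor depends neither on \<open>u\<close> nor on the
  starting index.\<close>

lemma geometric_decay:
  "\<exists>q\<ge>0. q < 1 \<and> (\<forall>u A i0 r k i. harmonic m W u \<longrightarrow> (\<forall>x\<in>cover_vertices m. \<bar>u x\<bar> \<le> A) \<longrightarrow>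
      (\<forall>i\<ge>i0. u (M 0 i) = 0 \<and> u (M m i) = 0) \<longrightarrow>
      k \<le> m \<longrightarrow> i \<ge> i0 + int r * int m \<longrightarrow> \<bar>u (M k i)\<bar> \<le> q ^ r * A)"
proof -
  obtain p where p: "0 < p" "p \<le> 1"
    "\<And>k i. Suc k < m \<Longrightarrow> p * (s (Suc k) i + t (Suc k) i + s k i + t k (i + 1)) \<le> s k i"
    using left_conductance_bound by blast
  have step: "\<bar>u (M k i)\<bar> \<le> (1 - p ^ m) * A"
    if u: "harmonic m W u" and A: "\<And>k i. k \<le> m \<Longrightarrow> i \<ge> i0 \<Longrightarrow> \<bar>u (M k i)\<bar> \<le> A"
      and zero: "\<And>i. i \<ge> i0 \<Longrightarrow> u (M 0 i) = 0 \<and> u (M m i) = 0"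
      and ki: "k \<le> m" "i \<ge> i0 + int m" for u A i0 k i
  proof -
    have A0: "A \<ge> 0" using A[of 0 i0] by simp
    have pk: "0 \<le> 1 - p ^ k" for k using p(1,2) power_le_one[of p k] by simp
    \<comment> \<open>Columns are treated from the left: only the straight left neighbour uses the
      improved bound of the previous column, the other three use \<open>A\<close>.\<close>
    have "i \<ge> i0 + int k \<Longrightarrow> k \<le> m \<Longrightarrow> \<bar>u (M k i)\<bar> \<le> (1 - p ^ k) * A" for k i
    proof (induction k arbitrary: i)
      case 0
      then show ?case using zero by simp
    next
      case (Suc k)
      show ?case
      proof (cases "Suc k = m")
        case True
        then have "u (M (Suc k) i) = 0" using zero[of i] Suc.prems by simp
        then show ?thesis using mult_nonneg_nonneg[OF pk[of "Suc k"] A0] by (simp del: power_Suc)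
      next
        case False
        then have k: "Suc k < m" using Suc.prems by simp
        let ?D = "s (Suc k) i + t (Suc k) i + s k i + t k (i + 1)"
        have pos: "s (Suc k) i > 0" "t (Suc k) i > 0" "s k i > 0" "t k (i + 1) > 0"
          using k straight_pos slanted_pos by auto
        have mean: "?D * u (M (Suc k) i) = s (Suc k) i * u (M (Suc (Suc k)) i) +
            t (Suc k) i * u (M (Suc (Suc k)) (i - 1)) + s k i * u (M k i) + t k (i + 1) * u (M k (i + 1))"
          using harmonicD[OF u _ k, of i] unfolding lap_Suc[OF k] by (simp add: algebra_simps)
        have "?D * \<bar>u (M (Suc k) i)\<bar> = \<bar>?D * u (M (Suc k) i)\<bar>"
          using pos by (simp add: abs_mult)
        also have "\<dots> = \<bar>s (Suc k) i * u (M (Suc (Suc k)) i) +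
            t (Suc k) i * u (M (Suc (Suc k)) (i - 1)) + s k i * u (M k i) + t k (i + 1) * u (M k (i + 1))\<bar>"
          by (simp only: mean)
        also have "\<dots> \<le> s (Suc k) i * A + t (Suc k) i * A + s k i * ((1 - p ^ k) * A) + t k (i + 1) * A"
        proof -
          have "\<bar>s (Suc k) i * u (M (Suc (Suc k)) i)\<bar> \<le> s (Suc k) i * A"
            "\<bar>t (Suc k) i * u (M (Suc (Suc k)) (i - 1))\<bar> \<le> t (Suc k) i * A"
            "\<bar>s k i * u (M k i)\<bar> \<le> s k i * ((1 - p ^ k) * A)"
            "\<bar>t k (i + 1) * u (M k (i + 1))\<bar> \<le> t k (i + 1) * A"
            using pos A k Suc.prems Suc.IH[of i] by (auto simp: abs_mult intro!: mult_left_mono)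
          then show ?thesis by linarith
        qed
        also have "\<dots> = ?D * A - s k i * (p ^ k * A)" by (simp add: algebra_simps)
        also have "\<dots> \<le> ?D * A - p * ?D * (p ^ k * A)"
          using mult_right_mono[OF p(3)[OF k, of i], of "p ^ k * A"] A0 p(1) by simp
        also have "\<dots> = ?D * ((1 - p ^ Suc k) * A)" by (simp add: algebra_simps)
        finally show ?thesis using pos by (simp add: mult_le_cancel_left_pos add_pos_pos)
      qed
    qed
    from this[of k i] have "\<bar>u (M k i)\<bar> \<le> (1 - p ^ k) * A" using ki by simp
    also have "\<dots> \<le> (1 - p ^ m) * A"
      using power_decreasing[OF ki(1), of p] p A0 by (intro mult_right_mono) auto
    finally show ?thesis .
  qed
  show ?thesis
  proof (intro exI[of _ "1 - p ^ m"] conjI allI impI)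
    show "0 \<le> 1 - p ^ m" "1 - p ^ m < 1"
      using p power_le_one[of p m] by simp_all
    fix u A i0 and r :: nat and k i
    assume u: "harmonic m W u" and A: "\<forall>x\<in>cover_vertices m. \<bar>u x\<bar> \<le> A"
      and zero: "\<forall>i\<ge>i0. u (M 0 i) = 0 \<and> u (M m i) = 0"
      and ki: "k \<le> m" "i \<ge> i0 + int r * int m"
    show "\<bar>u (M k i)\<bar> \<le> (1 - p ^ m) ^ r * A"
      using ki
    proof (induction r arbitrary: k i)
      case 0
      then show ?case using A by (auto simp: cover_vertices_def)
    next
      case (Suc r)
      have "\<bar>u (M k i)\<bar> \<le> (1 - p ^ m) * ((1 - p ^ m) ^ r * A)"
      proof (rule step[OF u, of "i0 + int r * int m"])
        show "u (M 0 i) = 0 \<and> u (M m i) = 0" if "i0 + int r * int m \<le> i" for i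
        proof -
          have "0 \<le> int r * int m" by simp
          with that have "i \<ge> i0" by linarith
          with zero show ?thesis by simp
        qed
      qed (use Suc in \<open>auto simp: algebra_simps\<close>)
      then show ?case by (simp add: mult.assoc)
    qed
  qed
qed

text \<open>With zero boundary values everywhere the starting index may be placed arbitrarily low,
  so the decay estimate holds for every power.\<close>

lemma bounded_harmonic_zero:
  assumes u: "harmonic m W u" "\<And>x. x \<in> cover_vertices m \<Longrightarrow> \<bar>u x\<bar> \<le> A"
    and zero: "\<And>x. x \<in> boundary_vertices m \<Longrightarrow> u x = 0" and x: "x \<in> cover_vertices m"
  shows "u x = 0"
proof -
  obtain k i where ki: "x = M k i" "k \<le> m" using x by (auto simp: cover_vertices_def)
  obtain q where q: "0 \<le> q" "q < 1"
    and decay: "\<And>i0 r k i. \<forall>i\<ge>i0. u (M 0 i) = 0 \<and> u (M m i) = 0 \<Longrightarrow>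
      k \<le> m \<Longrightarrow> i \<ge> i0 + int r * int m \<Longrightarrow> \<bar>u (M k i)\<bar> \<le> q ^ r * A"
    using geometric_decay u by metis
  have "u (M 0 i) = 0" "u (M m i) = 0" for i
    using zero[of "M 0 i"] zero[of "M m i"] by (simp_all add: boundary_vertices_iff del: Diff_iff)
  then have "\<bar>u x\<bar> \<le> q ^ r * A" for r
    using decay[of "i - int r * int m" k r i] ki by simp
  moreover have "(\<lambda>r. q ^ r * A) \<longlonglongrightarrow> 0"
    using q by (intro tendsto_mult_left_zero LIMSEQ_power_zero) auto
  ultimately have "\<bar>u x\<bar> \<le> 0"
    by (intro LIMSEQ_le_const) auto
  then show ?thesis by simp
qed

lemma harmonic_tendsto_zero:
  assumes u: "harmonic m W u" "\<And>x. x \<in> cover_vertices m \<Longrightarrow> \<bar>u x\<bar> \<le> A"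
    and zero: "\<And>i. i \<ge> i0 \<Longrightarrow> u (M 0 i) = 0 \<and> u (M m i) = 0" and "k \<le> m"
  shows "(\<lambda>j. u (M k (i + int n * int j))) \<longlonglongrightarrow> 0"
proof (rule LIMSEQ_I)
  fix e :: real assume e: "e > 0"
  obtain q where q: "0 \<le> q" "q < 1"
    and decay: "\<And>i0 r k i. \<forall>i\<ge>i0. u (M 0 i) = 0 \<and> u (M m i) = 0 \<Longrightarrow>
      k \<le> m \<Longrightarrow> i \<ge> i0 + int r * int m \<Longrightarrow> \<bar>u (M k i)\<bar> \<le> q ^ r * A"
    using geometric_decay u by metis
  have "(\<lambda>r. q ^ r * A) \<longlonglongrightarrow> 0"
    using q by (intro tendsto_mult_left_zero LIMSEQ_power_zero) auto
  from LIMSEQ_D[OF this e] obtain r where r: "\<bar>q ^ r * A\<bar> < e" by auto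
  define N where "N = nat (i0 + int r * int m - i)"
  have "\<bar>u (M k (i + int n * int j))\<bar> < e" if "j \<ge> N" for j
  proof -
    have "i0 + int r * int m - i \<le> int j" using that by (simp add: N_def)
    also have "\<dots> \<le> int n * int j" using mult_right_mono[of 1 "int n" "int j"] n_pos by simp
    finally have "\<bar>u (M k (i + int n * int j))\<bar> \<le> q ^ r * A"
      using zero \<open>k \<le> m\<close> by (intro decay[of i0]) auto
    with r show ?thesis by simp
  qed
  then show "\<exists>N. \<forall>j\<ge>N. norm (u (M k (i + int n * int j)) - 0) < e" by auto
qed

definition boundary_ball :: "nat \<Rightarrow> vertex set" where
  "boundary_ball N = (\<lambda>(k, i). M k i) ` ({0, m} \<times> {- int N..int N})"

lemma boundary_ball:
  "finite (boundary_ball N)" "boundary_ball N \<subseteq> boundary_vertices m"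
  "M k i \<in> boundary_ball N \<longleftrightarrow> (k = 0 \<or> k = m) \<and> \<bar>i\<bar> \<le> int N"
  by (auto simp: boundary_ball_def cover_vertices_def cover_interior_def abs_le_iff)

text \<open>No harmonic measure escapes to infinity: the partial sums increase to a bounded harmonic
  function with boundary values 1, and its difference from 1 is bounded with zero boundary
  values.\<close>

lemma poisson_kernel_total:
  assumes U: "poisson_kernel m W U" and x: "x \<in> cover_vertices m"
  shows "(\<lambda>N. \<Sum>b\<in>boundary_ball N. U b x) \<longlonglongrightarrow> 1"
proof -
  define v where "v x = lim (\<lambda>N. \<Sum>b\<in>boundary_ball N. U b x)" for x
  have conv: "(\<lambda>N. \<Sum>b\<in>boundary_ball N. U b x) \<longlonglongrightarrow> v x" if x: "x \<in> cover_vertices m" for x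
  proof -
    have "convergent (\<lambda>N. \<Sum>b\<in>boundary_ball N. U b x)"
    proof (rule Bseq_mono_convergent)
      have "0 \<le> (\<Sum>b\<in>boundary_ball N. U b x)" for N
        by (intro sum_nonneg poisson_kernelD(3)[OF U _ x]) (use boundary_ball(2) in blast)
      then show "Bseq (\<lambda>N. \<Sum>b\<in>boundary_ball N. U b x)"
        using poisson_kernelD(4)[OF U boundary_ball(1,2) x]
        by (intro BseqI'[where K = 1]) auto
      show "\<forall>N N'. N \<le> N' \<longrightarrow> (\<Sum>b\<in>boundary_ball N. U b x) \<le> (\<Sum>b\<in>boundary_ball N'. U b x)"
      proof (intro allI impI sum_mono2 boundary_ball(1))
        fix N N' :: nat assume "N \<le> N'"
        then show "boundary_ball N \<subseteq> boundary_ball N'" by (auto simp: boundary_ball_def)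
      qed (use poisson_kernelD(3)[OF U _ x] boundary_ball(2) in blast)
    qed
    then show ?thesis by (simp add: v_def convergent_LIMSEQ_iff)
  qed
  have v_bounds: "0 \<le> v x \<and> v x \<le> 1" if x: "x \<in> cover_vertices m" for x
  proof
    have "0 \<le> (\<Sum>b\<in>boundary_ball N. U b x)" for N
      by (intro sum_nonneg poisson_kernelD(3)[OF U _ x]) (use boundary_ball(2) in blast)
    then show "0 \<le> v x" using LIMSEQ_le_const[OF conv[OF x]] by auto
    show "v x \<le> 1"
      using LIMSEQ_le_const2[OF conv[OF x]] poisson_kernelD(4)[OF U boundary_ball(1,2) x] by auto
  qed
  have v_bd: "v x = 1" if x: "x \<in> boundary_vertices m" for x
  proof -
    obtain k i where ki: "x = M k i" "k = 0 \<or> k = m"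
      using x by (cases x) (simp only: boundary_vertices_iff)
    have "(\<Sum>b\<in>boundary_ball N. U b x) = 1" if "N \<ge> nat \<bar>i\<bar>" for N
    proof -
      have "(\<Sum>b\<in>boundary_ball N. U b x) = (\<Sum>b\<in>boundary_ball N. if b = x then 1 else 0)"
        using poisson_kernelD(2)[OF U _ x] boundary_ball(2)[of N]
        by (intro sum.cong) (auto simp: delta_def)
      also have "\<dots> = 1" using ki that boundary_ball(1)[of N] boundary_ball(3)[of k i N] by simp
      finally show ?thesis .
    qed
    then have "(\<lambda>N. \<Sum>b\<in>boundary_ball N. U b x) \<longlonglongrightarrow> 1"
      by (intro tendsto_eventually eventually_sequentiallyI[of "nat \<bar>i\<bar>"]) auto
    then show ?thesis using conv[of x] x LIMSEQ_unique by blast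
  qed
  have lap_v: "lap m W v x = 0" if x: "x \<in> cover_interior m" for x
  proof (rule LIMSEQ_unique)
    show "(\<lambda>N. lap m W (\<lambda>x. \<Sum>b\<in>boundary_ball N. 1 * U b x) x) \<longlonglongrightarrow> lap m W v x"
      by (rule lap_tendsto) (simp add: conv)
    have "lap m W (\<lambda>x. \<Sum>b\<in>boundary_ball N. 1 * U b x) x = 0" for N
      unfolding lap_sum[OF boundary_ball(1)]
      using poisson_kernelD(1)[OF U] boundary_ball(2)[of N] x by (intro sum.neutral) (auto simp: harmonic_def)
    then show "(\<lambda>N. lap m W (\<lambda>x. \<Sum>b\<in>boundary_ball N. 1 * U b x) x) \<longlonglongrightarrow> 0" by simp
  qed
  have "1 * 1 + (- 1) * v x = 0"
  proof (rule bounded_harmonic_zero[of "\<lambda>x. 1 * 1 + (- 1) * v x" 1, OF _ _ _ x])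
    have "lap m W (\<lambda>_. 1) x = 0" for x by (cases x) (simp add: lap_def)
    then show "harmonic m W (\<lambda>x. 1 * 1 + (- 1) * v x)"
      unfolding harmonic_def lap_linear using lap_v by simp
    show "\<bar>1 * 1 + (- 1) * v x\<bar> \<le> 1" if "x \<in> cover_vertices m" for x
      using v_bounds[OF that] by auto
    show "1 * 1 + (- 1) * v x = 0" if "x \<in> boundary_vertices m" for x
      using v_bd[OF that] by simp
  qed
  then show ?thesis using conv[OF x] by simp
qed

end

lemma left_layer_determined:
  assumes strips: "strip n m W" "strip n m W'"
    and sorted: "strip.sorted_radii n m W" "strip.sorted_radii n m W'"
    and same: "same_response m W W'"
  shows "W' (Straight 0 i) = W (Straight 0 i)" and "W' (Slanted 0 i) = W (Slanted 0 i)"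
proof -
  interpret N: strip n m W by fact
  interpret N': strip n m W' by fact
  note rel = left_layer_relation[OF strips sorted same]
  have pos: "N.s 0 i > 0" "N.t 0 i > 0" for i
    using N.straight_pos N.slanted_pos N.m_pos by auto
  obtain H where H: "\<And>i. H i > 0" "\<And>i. N.t 0 (i + 1) * H (i + 1) = N.s 0 i * H i"
    using N.slanted_mode by blast
  define h where "h i = alt i * H i" for i
  have h_nz: "h i \<noteq> 0" for i using H(1)[of i] by (simp add: h_def)
  have h: "N.t 0 (i + 1) * h (i + 1) = - N.s 0 i * h i" for i
  proof -
    have "N.t 0 (i + 1) * h (i + 1) = - alt i * (N.t 0 (i + 1) * H (i + 1))" by (simp add: h_def)
    then show ?thesis unfolding H(2) by (simp add: h_def)
  qed
  \<comment> \<open>Equality of the ratios means that \<open>s 0 i\<close> and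
    \<open>t 0 (i + 1)\<close>, the two edges entering column 1 at \<open>i\<close>, respectively
    \<open>M 0 i\<close> to \<open>M 1 i\<close> and \<open>M 0 (i + 1)\<close> to
    \<open>M 1 i\<close>, are rescaled by a common factor \<open>\<mu> i\<close>.\<close>
  define \<mu> where "\<mu> i = N'.s 0 i / N.s 0 i" for i
  have \<mu>: "N'.s 0 i = \<mu> i * N.s 0 i" "N'.t 0 (i + 1) = \<mu> i * N.t 0 (i + 1)" for i
    using pos[of i] rel(1)[of i] by (simp_all add: \<mu>_def field_simps)
  \<comment> \<open>Equal sums make the changes of \<open>t 0 i\<close> and \<open>s 0 i\<close>
    opposite. Together with the common factor this gives a first-order recursion, so
    \<open>\<delta> * h\<close> is constant.\<close>
  define \<delta> where "\<delta> i = N'.t 0 i - N.t 0 i" for i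
  have \<delta>_s: "\<delta> i = - (N'.s 0 i - N.s 0 i)" for i using rel(2)[of i] by (simp add: \<delta>_def)
  have "\<delta> (i + 1) * h (i + 1) = \<delta> i * h i" for i
  proof -
    have "\<delta> (i + 1) = (\<mu> i - 1) * N.t 0 (i + 1)" using \<mu>(2)[of i] by (simp add: \<delta>_def left_diff_distrib)
    then have "\<delta> (i + 1) * h (i + 1) = (\<mu> i - 1) * (N.t 0 (i + 1) * h (i + 1))" by simp
    also have "\<dots> = - ((\<mu> i - 1) * N.s 0 i) * h i" unfolding h by simp
    also have "(\<mu> i - 1) * N.s 0 i = - \<delta> i" by (simp add: \<delta>_s \<mu>(1) algebra_simps)
    finally show ?thesis by simp
  qed
  then have \<delta>h: "\<delta> i * h i = \<delta> j * h j" for i j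
    by (rule int_shift_invariant_all[where f = "\<lambda>i. \<delta> i * h i"])
  \<comment> \<open>A nonzero \<open>\<delta>\<close> is periodic and inversely proportional to \<open>h\<close>, so this is the case \<open>R\<^sub>1 = 1\<close>, \<open>n\<close> even.\<close>
  have "\<delta> j = 0" for j
  proof (rule ccontr)
    assume "\<delta> j \<noteq> 0"
    then have \<delta>_nz: "\<delta> i \<noteq> 0" for i using \<delta>h[of i j] h_nz[of j] by auto
    have "\<delta> (i + int n) = \<delta> i" for i
      by (simp add: \<delta>_def N.slanted_periodic N'.slanted_periodic)
    then have h_per: "h (i + int n) = h i" for i
      using \<delta>h[of "i + int n" i] \<delta>_nz[of i] by simp
    obtain U U' where U: "poisson_kernel m W U" "poisson_kernel m W' U'"
      and eq: "\<And>u v. u \<in> boundary_vertices m \<Longrightarrow> v \<in> boundary_vertices m \<Longrightarrow>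
        lap m W (U v) u = lap m W' (U' v) u"
      using same unfolding same_response_def by blast
    define B where "B = N.boundary_ball"
    have B: "finite (B N)" "B N \<subseteq> boundary_vertices m" for N
      using N.boundary_ball by (auto simp: B_def)
    define f f' where "f N x = (\<Sum>b\<in>B N. 1 * U b x)" and "f' N x = (\<Sum>b\<in>B N. 1 * U' b x)" for N x
    have harm: "harmonic m W (f N)" "harmonic m W' (f' N)" for N
      using poisson_kernelD(1)[OF U(1)] poisson_kernelD(1)[OF U(2)] B(2)[of N]
      unfolding f_def f'_def harmonic_def lap_sum[OF B(1)] by (auto intro!: sum.neutral)
    have bounds: "\<bar>f N x\<bar> \<le> 1" "\<bar>f' N x\<bar> \<le> 1" if x: "x \<in> cover_vertices m" for N x
    proof -
      have "0 \<le> f N x" "0 \<le> f' N x"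
        using poisson_kernelD(3)[OF U(1) _ x] poisson_kernelD(3)[OF U(2) _ x] B(2)[of N]
        by (auto simp: f_def f'_def intro!: sum_nonneg)
      moreover have "f N x \<le> 1" "f' N x \<le> 1"
        using poisson_kernelD(4)[OF U(1) B x] poisson_kernelD(4)[OF U(2) B x]
        by (auto simp: f_def f'_def)
      ultimately show "\<bar>f N x\<bar> \<le> 1" "\<bar>f' N x\<bar> \<le> 1" by auto
    qed
    have bd: "f N x = (if x \<in> B N then 1 else 0)" "f' N x = (if x \<in> B N then 1 else 0)"
      if x: "x \<in> boundary_vertices m" for N x
    proof -
      have "f N x = (\<Sum>b\<in>B N. if b = x then 1 else 0)" "f' N x = (\<Sum>b\<in>B N. if b = x then 1 else 0)"
        using poisson_kernelD(2)[OF U(1) _ x] poisson_kernelD(2)[OF U(2) _ x] B(2)[of N]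
        unfolding f_def f'_def by (auto intro!: sum.cong simp: delta_def)
      then show "f N x = (if x \<in> B N then 1 else 0)" "f' N x = (if x \<in> B N then 1 else 0)"
        using B(1) by simp_all
    qed
    have lap_eq: "lap m W (f N) x = lap m W' (f' N) x" if "x \<in> boundary_vertices m" for N x
      unfolding f_def f'_def lap_sum[OF B(1)]
      using eq[OF that] B(2)[of N] by (intro sum.cong) auto
    have zero: "f N (M 0 i) = 0 \<and> f N (M m i) = 0" "f' N (M 0 i) = 0 \<and> f' N (M m i) = 0"
      if "i \<ge> int N + 1" for N i
      using bd[of "M 0 i" N] bd[of "M m i" N] that
      by (simp_all add: boundary_vertices_iff B_def N.boundary_ball(3) del: Diff_iff)
    \<comment> \<open>Since \<open>\<mu> i\<close> scales both edges entering \<open>M 1 i\<close>,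
      weighting \<open>f'\<close> by it turns the equality of left currents into a homogeneous
      two-term recursion for \<open>d N\<close>.\<close>
    define d where "d N i = f N (M 1 i) - \<mu> i * f' N (M 1 i)" for N i
    have d_rec: "N.s 0 i * d N i = - N.t 0 i * d N (i - 1)" for N i
    proof -
      have bv: "M 0 i \<in> boundary_vertices m" by (simp add: boundary_vertices_iff del: Diff_iff)
      have "f N (M 0 i) = f' N (M 0 i)" using bd[OF bv] by simp
      with lap_eq[OF bv, of N]
      have "N.s 0 i * f N (M 1 i) + N.t 0 i * f N (M 1 (i - 1)) =
          N'.s 0 i * f' N (M 1 i) + N'.t 0 i * f' N (M 1 (i - 1)) +
          ((N.s 0 i + N.t 0 i) - (N'.s 0 i + N'.t 0 i)) * f' N (M 0 i)"
        unfolding N.lap_left N'.lap_left by (simp add: algebra_simps)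
      also have "(N.s 0 i + N.t 0 i) - (N'.s 0 i + N'.t 0 i) = 0" using rel(2)[of i] by simp
      also have "N'.t 0 i = \<mu> (i - 1) * N.t 0 i" using \<mu>(2)[of "i - 1"] by simp
      finally show ?thesis unfolding \<mu>(1)[of i] by (simp add: d_def algebra_simps)
    qed
    \<comment> \<open>The quantity \<open>s * h * d\<close> is constant in the index, and
      \<open>s\<close> and \<open>h\<close> are periodic, so \<open>d N\<close> is periodic. It also
      tends to 0 along shifts, because the boundary values of \<open>f N\<close> and
      \<open>f' N\<close> vanish beyond \<open>N\<close>.\<close>
    have "d N i = 0" for N i
    proof -
      have "N.s 0 (i + 1) * h (i + 1) * d N (i + 1) = N.s 0 i * h i * d N i" for i
      proof -
        have "N.s 0 (i + 1) * h (i + 1) * d N (i + 1) = h (i + 1) * (N.s 0 (i + 1) * d N (i + 1))"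
          by simp
        also have "\<dots> = - (N.t 0 (i + 1) * h (i + 1)) * d N i"
          unfolding d_rec by simp
        finally show ?thesis unfolding h by simp
      qed
      then have const: "N.s 0 j * h j * d N j = N.s 0 j' * h j' * d N j'" for j j'
        by (rule int_shift_invariant_all[where f = "\<lambda>j. N.s 0 j * h j * d N j"])
      have d_per: "d N (j + int n) = d N j" for j
        using const[of "j + int n" j] h_nz[of j] pos(1)[of j] by (simp add: h_per N.straight_periodic)
      have \<mu>_per: "\<mu> (j + int n) = \<mu> j" for j
        by (simp add: \<mu>_def N.straight_periodic N'.straight_periodic)
      have "(\<lambda>j. f N (M 1 (i + int n * int j)) - \<mu> i * f' N (M 1 (i + int n * int j))) \<longlonglongrightarrow> 0 - \<mu> i * 0"
        using N.harmonic_tendsto_zero[OF harm(1) bounds(1) zero(1) N.m_pos]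
          N'.harmonic_tendsto_zero[OF harm(2) bounds(2) zero(2) N.m_pos]
        by (intro tendsto_intros) auto
      moreover have "f N (M 1 (i + int n * int j)) - \<mu> i * f' N (M 1 (i + int n * int j)) = d N i" for j
        using periodic_multiple[of "d N" n i "int j", OF d_per] periodic_multiple[of \<mu> n i "int j", OF \<mu>_per]
        by (simp add: d_def)
      ultimately show ?thesis by (simp add: LIMSEQ_const_iff)
    qed
    \<comment> \<open>Letting \<open>N\<close> grow, both extensions tend to 1, which leaves
      \<open>\<mu> j = 1\<close> and contradicts \<open>\<delta> j \<noteq> 0\<close>.\<close>
    then have "f N (M 1 j) = \<mu> j * f' N (M 1 j)" for N by (simp add: d_def)
    moreover have "M 1 j \<in> cover_vertices m" using N.m_pos by (simp add: cover_vertices_def)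
    then have "(\<lambda>N. f N (M 1 j)) \<longlonglongrightarrow> 1" "(\<lambda>N. f' N (M 1 j)) \<longlonglongrightarrow> 1"
      using N.poisson_kernel_total[OF U(1)] N'.poisson_kernel_total[OF U(2)]
      by (simp_all add: f_def f'_def B_def)
    ultimately have "(\<lambda>N. f N (M 1 j)) \<longlonglongrightarrow> \<mu> j * 1"
      using tendsto_mult_left[of "\<lambda>N. f' N (M 1 j)" 1 sequentially "\<mu> j"] by simp
    with \<open>(\<lambda>N. f N (M 1 j)) \<longlonglongrightarrow> 1\<close> have "\<mu> j = 1" using LIMSEQ_unique by fastforce
    then show False using \<delta>_nz[of j] \<mu>(1)[of j] by (simp add: \<delta>_s)
  qed
  then show "W' (Straight 0 i) = W (Straight 0 i)" "W' (Slanted 0 i) = W (Slanted 0 i)"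
    using rel(2)[of i] by (auto simp: \<delta>_def)
qed

section \<open>From cylinder networks to periodic strips, and the conclusion\<close>

lemma strip_lift:
  assumes "n \<ge> 1" "m \<ge> 1" and w: "\<forall>f\<in>cylinder_edges n m. w f > 0"
  shows "strip n m (lift n w)"
proof
  fix k i assume "k < m"
  then have "Straight k (i mod int n) \<in> cylinder_edges n m" "Slanted k (i mod int n) \<in> cylinder_edges n m"
    using assms(1) by (auto simp: cylinder_edges_def)
  then show "lift n w (Straight k i) > 0" "lift n w (Slanted k i) > 0"
    using w by (auto simp: lift_def)
qed (use assms in \<open>auto simp: lift_def\<close>)

lemma sorted_radii_lift:
  assumes "strip n m (lift n w)" and "\<forall>k. 1 \<le> k \<and> k < m \<longrightarrow> radius n w k \<ge> radius n w (k + 1)"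
  shows "strip.sorted_radii n m (lift n w)"
proof -
  interpret strip n m "lift n w" by fact
  have "layer_radius k = radius n w (Suc k)" for k
    using prod_period_int[of "s k" n 0 1, OF straight_periodic]
      prod_period_int[of "t k" n 0 1, OF slanted_periodic]
      atLeastLessThanPlusOne_atLeastAtMost_int[of 1 "int n"]
    by (simp add: layer_radius_def radius_def add.commute)
  then show ?thesis
    using assms(2) by (simp add: sorted_radii_def)
qed

lemma same_response_lift:
  assumes strips: "strip n m (lift n w)" "strip n m (lift n w')"
    and V: "exhaustion m V" "exhaustion m V'"
    and eq: "universal_response n m w V = universal_response n m w' V'"
  shows "same_response m (lift n w) (lift n w')"
proof -
  have ex: "\<exists>U. poisson_kernel m (lift n w) U \<and>
      (\<forall>b c. universal_response n m w V b c = lap m (lift n w) (U (boundary_vertex m c)) (boundary_vertex m b))"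
    if N: "strip n m (lift n w)" and V: "exhaustion m V" for w V
  proof -
    interpret strip n m "lift n w" by fact
    obtain U where U: "poisson_kernel m (lift n w) U"
      "\<And>u v. u \<in> boundary_vertices m \<Longrightarrow> v \<in> boundary_vertices m \<Longrightarrow>
      (\<lambda>N. response {e \<in> cover_edges m. ends e \<inter> V N \<noteq> {}} ends (lift n w) (V N \<inter> cover_interior m) u v)
        \<longlonglongrightarrow> lap m (lift n w) (U v) u"
      using poisson_kernel_exists[OF V] by blast
    have "boundary_vertex m b \<in> boundary_vertices m" for b
      by (cases b) (simp_all add: boundary_vertices_iff del: Diff_iff)
    then have "universal_response n m w V b c = lap m (lift n w) (U (boundary_vertex m c)) (boundary_vertex m b)" for b c
      unfolding universal_response_def truncated_response_def by (intro limI U(2))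
    with U(1) show ?thesis by blast
  qed
  obtain U where U: "poisson_kernel m (lift n w) U"
    "\<And>b c. universal_response n m w V b c = lap m (lift n w) (U (boundary_vertex m c)) (boundary_vertex m b)"
    using ex[OF strips(1) V(1)] by blast
  obtain U' where U': "poisson_kernel m (lift n w') U'"
    "\<And>b c. universal_response n m w' V' b c = lap m (lift n w') (U' (boundary_vertex m c)) (boundary_vertex m b)"
    using ex[OF strips(2) V(2)] by blast
  have surj: "\<exists>b. x = boundary_vertex m b" if "x \<in> boundary_vertices m" for x
  proof (cases x)
    case (M k i)
    with that have "k = 0 \<or> k = m" by (simp only: boundary_vertices_iff)
    then show ?thesis
      using M by (metis boundary_vertex.simps)
  qed
  have "lap m (lift n w) (U v) u = lap m (lift n w') (U' v) u"
    if "u \<in> boundary_vertices m" "v \<in> boundary_vertices m" for u v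
    using surj[OF that(1)] surj[OF that(2)] U(2) U'(2) eq by metis
  then show ?thesis
    unfolding same_response_def using U(1) U'(1) by blast
qed

lemma eval_poly_const: "eval_poly (Poly_Mapping.single 0 a) X = a"
  by (cases "a = 0") (simp_all add: eval_poly_def)

theorem theorem5p12:
  fixes n m :: nat and e :: edge and j :: int
  assumes "n \<ge> 1" and "m \<ge> 1"
    and "e \<in> cover_edges m" and "M 0 j \<in> ends e"
  shows "\<exists>P Q :: (boundary \<Rightarrow> boundary \<Rightarrow> real) \<Rightarrow> nat \<Rightarrow> response_poly.
    \<forall>(w :: edge \<Rightarrow> real) V.
      (\<forall>f \<in> cylinder_edges n m. w f > 0) \<longrightarrow>
      (\<forall>k. 1 \<le> k \<and> k < m \<longrightarrow> radius n w k \<ge> radius n w (k + 1)) \<longrightarrow>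
      exhaustion m V \<longrightarrow>
      (let \<L> = universal_response n m w V in
        (\<forall>K\<ge>1. eval_poly (Q \<L> K) \<L> \<noteq> 0) \<and>
        (\<lambda>K. eval_poly (P \<L> K) \<L> / eval_poly (Q \<L> K) \<L>) \<longlonglongrightarrow> lift n w e)"
proof -
  \<comment> \<open>The witnesses are constant polynomials; their coefficients depend on the response matrix.\<close>
  define network where "network w V \<L> \<longleftrightarrow> (\<forall>f \<in> cylinder_edges n m. w f > 0) \<and>
    (\<forall>k. 1 \<le> k \<and> k < m \<longrightarrow> radius n w k \<ge> radius n w (k + 1)) \<and>
    exhaustion m V \<and> \<L> = universal_response n m w V" for w V \<L>
  have determined: "lift n w' e = lift n w e" if "network w V \<L>" "network w' V' \<L>" for w V w' V' \<L>
  proof -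
    have strips: "strip n m (lift n w)" "strip n m (lift n w')"
      using strip_lift[OF assms(1,2)] that by (auto simp: network_def)
    moreover have "strip.sorted_radii n m (lift n w)" "strip.sorted_radii n m (lift n w')"
      using sorted_radii_lift strips that by (auto simp: network_def)
    moreover have "same_response m (lift n w) (lift n w')"
      using that by (intro same_response_lift[OF strips, of V V']) (auto simp: network_def)
    ultimately have "lift n w' (Straight 0 i) = lift n w (Straight 0 i)"
      "lift n w' (Slanted 0 i) = lift n w (Slanted 0 i)" for i
      using left_layer_determined by blast+
    then show ?thesis using assms(4) by (cases e) auto
  qed
  \<comment> \<open>A choice among all networks with this response matrix; by
    \<open>determined\<close> they agree on the edge \<open>e\<close>. For a matrix that comes from
    no such network the value is arbitrary.\<close>
  define a where "a \<L> = (SOME a. \<exists>w V. network w V \<L> \<and> a = lift n w e)" for \<L>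
  have a: "a \<L> = lift n w e" if "network w V \<L>" for w V \<L>
  proof -
    have "\<exists>w V. network w V \<L> \<and> a \<L> = lift n w e"
      unfolding a_def by (rule someI_ex) (use that in blast)
    then show ?thesis using determined that by metis
  qed
  show ?thesis
    by (rule exI[of _ "\<lambda>\<L> K. Poly_Mapping.single 0 (a \<L>)"], rule exI[of _ "\<lambda>\<L> K. Poly_Mapping.single 0 1"])
      (use a eval_poly_const[of 1] in \<open>auto simp: Let_def eval_poly_const network_def\<close>)
qed

end
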